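(* Let $q$ range over prime powers with $q\equiv 3\pmod 4$, and let $r=r(q)$ be a positive integer with $r\equiv 0$ or $1\pmod 4$, $r\to\infty$ and $r/q^{1/4}\to 0$ as $q\to\infty$. Let $\tilde N_r$ denote the number of subsets $S\subseteq\mathbb{F}_q$ with $|S|=r$ such that the induced subdigraph $PT_q[S]$ of the Paley tournament is even. Then $$\tilde N_r=(1+o(1))\,2^{1-r}\binom{q}{r}\quad\text{as } q\to\infty.$$
   Context: For $q\equiv 3\pmod 4$ a prime power, the Paley tournament $PT_q$ is the digraph on $\mathbb{F}_q$ in which $(x,y)$ is an arc iff $x-y$ is a nonzero square in $\mathbb{F}_q$ (a tournament since $-1$ is a nonsquare). For $S\subseteq\mathbb{F}_q$, the out-degree of $v\in S$ in $PT_q[S]$ is the number of $y\in S$ with $(v,y)$ an arc. An induced subdigraph is even if every vertex has even out-degree in it. *)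

theory Defs
  imports
    "HOL-Algebra.Ring"
    "HOL-Number_Theory.Prime_Powers"
    "HOL-Library.Landau_Symbols"
    "HOL-Analysis.Analysis"
    "Graph_Theory.Digraph_Component"
begin

definition nonzero_square :: "('a, 'm) ring_scheme \<Rightarrow> 'a \<Rightarrow> bool" where
  "nonzero_square R a \<longleftrightarrow> a \<noteq> \<zero>\<^bsub>R\<^esub> \<and> (\<exists>z\<in>carrier R. a = z [^]\<^bsub>R\<^esub> (2::nat))"

text \<open>An arc is the ordered pair (x, y), pointing from x to y, whenever x - y is a nonzero square.\<close>

definition paley_tournament :: "('a, 'm) ring_scheme \<Rightarrow> ('a, 'a \<times> 'a) pre_digraph" where
  "paley_tournament R =
     \<lparr> verts = carrier R,
       arcs = {(x, y). x \<in> carrier R \<and> y \<in> carrier R \<and> nonzero_square R (x \<ominus>\<^bsub>R\<^esub> y)},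
       tail = fst, head = snd \<rparr>"

definition even_digraph :: "('a, 'b) pre_digraph \<Rightarrow> bool" where
  "even_digraph G \<longleftrightarrow> (\<forall>v\<in>verts G. even (out_degree G v))"

definition num_even_induced :: "('a, 'b) pre_digraph \<Rightarrow> nat \<Rightarrow> nat" where
  "num_even_induced G r = card {S. S \<subseteq> verts G \<and> card S = r \<and> even_digraph (G \<restriction> S)}"

definition paley_orders :: "nat set" where
  "paley_orders = {q. primepow q \<and> q mod 4 = 3}"

definition paley_at_top :: "nat filter" where
  "paley_at_top = inf at_top (principal paley_orders)"

end

theory Submission
  imports Defs "HOL-Algebra.Multiplicative_Group" "HOL-Computational_Algebra.Polynomial"
begin

text \<open>
  Let \<open>\<chi>\<close> be the quadratic character. Since \<open>\<chi>(-1) = -1\<close>, a set \<open>S\<close> induces an even subdigraph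
  iff \<open>\<Prod>\<^bsub>y\<in>S-{v}\<^esub> \<chi>(y - v) = 1\<close> for all \<open>v \<in> S\<close>, so its indicator is
  \<open>2\<^sup>-\<^sup>r \<Sum>\<^bsub>T\<subseteq>S\<^esub> \<plusminus>\<Prod>\<^bsub>v\<in>T, y\<in>S-T\<^esub> \<chi>(y - v)\<close>, the sign depending only on \<open>|T|\<close>. The terms \<open>T = {}\<close>
  and \<open>T = S\<close> give the main term. For the others, fix the smaller one of \<open>T\<close> and \<open>S - T\<close>, say \<open>T\<close>;
  summing over the other set gives an elementary symmetric function of the values
  \<open>\<Prod>\<^bsub>v\<in>T\<^esub> \<chi>(y - v)\<close>. It is at most \<open>(q/32)\<^sup>s / s!\<close> with \<open>s = |S - T|\<close> as soon as the sum of these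
  values over \<open>y\<close> is at most \<open>q/64\<close>, and this beats the \<open>2\<^sup>r\<close> choices of \<open>T\<close>.

  This weak form of Weil's bound is proved by Stepanov's method: with \<open>f = \<Prod>\<^bsub>a\<in>T\<^esub> (X - a)\<close> and
  \<open>n = (q - 1)/2\<close>, the pigeonhole principle gives a nonzero polynomial
  \<open>R = \<Sum>\<^sub>j (r\<^sub>j + s\<^sub>j f\<^sup>n) X\<^sup>j\<^sup>q\<close> that vanishes to order \<open>l\<close> at every \<open>x\<close> with \<open>f(x)\<^sup>n = \<epsilon>\<close>, where
  \<open>\<epsilon>\<close> is a fixed sign, and these points are then counted by the degree of \<open>R\<close>.

  The field of order \<open>q\<close> is a carrier set and not a type. To have the polynomials of the type class
  hierarchy at hand, it is presented as the quotient of the ring of integer polynomials by a prime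
  ideal, and Stepanov's argument is carried out with congruences modulo that ideal.
\<close>

hide_const (open) UnivPoly.coeff UnivPoly.monom Module.smult

subsection \<open>Stepanov's method modulo a prime ideal\<close>

locale ring_ideal =
  fixes I :: "'a::comm_ring_1 set"
  assumes zero_mem [simp]: "0 \<in> I"
    and add_mem: "a \<in> I \<Longrightarrow> b \<in> I \<Longrightarrow> a + b \<in> I"
    and mult_mem: "b \<in> I \<Longrightarrow> a * b \<in> I"
begin

lemma mult_mem_right: "a \<in> I \<Longrightarrow> a * b \<in> I"
  using mult_mem[of a b] by (simp add: mult.commute)

lemma minus_mem: "a \<in> I \<Longrightarrow> - a \<in> I"
  using mult_mem[of a "-1"] by simp

lemma diff_mem: "a \<in> I \<Longrightarrow> b \<in> I \<Longrightarrow> a - b \<in> I"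
  using add_mem[of a "-b"] minus_mem[of b] by simp

lemma sum_mem: "(\<And>x. x \<in> S \<Longrightarrow> h x \<in> I) \<Longrightarrow> sum h S \<in> I"
  by (induction S rule: infinite_finite_induct) (auto intro: add_mem)

lemma mem_iff_of_diff_mem: "a - b \<in> I \<Longrightarrow> a \<in> I \<longleftrightarrow> b \<in> I"
  using add_mem[of "a - b" b] diff_mem[of a "a - b"] by auto

definition icong :: "'a \<Rightarrow> 'a \<Rightarrow> bool"
  where "icong a b \<longleftrightarrow> a - b \<in> I"

lemma icong_refl [simp]: "icong a a"
  by (simp add: icong_def)

lemma icong_sym: "icong a b \<Longrightarrow> icong b a"
  using minus_mem[of "a - b"] by (simp add: icong_def)

lemma icong_trans [trans]: "icong a b \<Longrightarrow> icong b c \<Longrightarrow> icong a c"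
  using add_mem[of "a - b" "b - c"] by (simp add: icong_def)

lemma icong_add: "icong a b \<Longrightarrow> icong c d \<Longrightarrow> icong (a + c) (b + d)"
  using add_mem[of "a - b" "c - d"] by (simp add: icong_def algebra_simps)

lemma icong_mult:
  assumes "icong a b" "icong c d"
  shows "icong (a * c) (b * d)"
proof -
  have "a * c - b * d = c * (a - b) + b * (c - d)"
    by (simp add: algebra_simps)
  then show ?thesis
    using assms unfolding icong_def by (metis add_mem mult_mem)
qed

lemma icong_power: "icong a b \<Longrightarrow> icong (a ^ k) (b ^ k)"
  by (induction k) (auto intro: icong_mult)

lemma icong_sum: "(\<And>x. x \<in> S \<Longrightarrow> icong (h x) (k x)) \<Longrightarrow> icong (sum h S) (sum k S)"
  by (induction S rule: infinite_finite_induct) (auto intro: icong_add)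

lemma icong_mem_iff: "icong a b \<Longrightarrow> a \<in> I \<longleftrightarrow> b \<in> I"
  by (simp add: icong_def mem_iff_of_diff_mem)

lemma icong_frobenius_prime:
  assumes p: "prime p" "of_nat p \<in> I"
  shows "icong ((a + b) ^ p) (a ^ p + b ^ p)"
proof -
  let ?t = "\<lambda>k. of_nat (p choose k) * a ^ k * b ^ (p - k)"
  have p0: "p > 0"
    using p prime_gt_0_nat by blast
  have "(a + b) ^ p = (\<Sum>k\<le>p. ?t k)"
    by (rule binomial_ring)
  also have "{..p} = insert 0 (insert p {1..<p})"
    using p0 by auto
  also have "(\<Sum>k\<in>\<dots>. ?t k) = b ^ p + (a ^ p + (\<Sum>k\<in>{1..<p}. ?t k))"
    using p0 by (subst sum.insert) (auto simp: sum.insert)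
  finally have eq: "(a + b) ^ p - (a ^ p + b ^ p) = (\<Sum>k\<in>{1..<p}. ?t k)"
    by (simp add: algebra_simps)
  have "?t k \<in> I" if "k \<in> {1..<p}" for k
  proof -
    have "p dvd (p choose k)"
      using that p by (intro dvd_choose_prime) auto
    then obtain c where "p choose k = p * c" by blast
    then have "?t k = (of_nat c * a ^ k * b ^ (p - k)) * of_nat p"
      by (simp add: algebra_simps)
    then show ?thesis
      using p mult_mem by metis
  qed
  then show ?thesis
    unfolding icong_def eq by (rule sum_mem)
qed

lemma icong_frobenius:
  assumes p: "prime p" "of_nat p \<in> I"
  shows "icong ((a + b) ^ p ^ e) (a ^ p ^ e + b ^ p ^ e)"
proof (induction e)
  case (Suc e)
  have "icong (((a + b) ^ p ^ e) ^ p) ((a ^ p ^ e + b ^ p ^ e) ^ p)"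
    by (rule icong_power[OF Suc])
  also have "icong \<dots> ((a ^ p ^ e) ^ p + (b ^ p ^ e) ^ p)"
    by (rule icong_frobenius_prime[OF p])
  finally show ?case
    by (simp add: power_mult[symmetric] mult.commute)
qed simp

end

section \<open>Polynomials with coefficients in \<open>I\<close>, entirely or below a given
  order\<close>

lemma pcompose_power: "pcompose (u ^ k) v = pcompose u v ^ k"
  by (induction k) (simp_all add: pcompose_mult pcompose_1)

text \<open>The kernel of reducing coefficients modulo \<open>I\<close>: membership encodes being
  the zero polynomial over the residue ring.\<close>

definition poly_ideal :: "'a::comm_ring_1 set \<Rightarrow> 'a poly set"
  where "poly_ideal I = {u. \<forall>k. coeff u k \<in> I}"

text \<open>The ideal generated by \<open>I\<close> and \<open>X^l\<close>. As
  \<open>pcompose u [:x, 1:]\<close> is the Taylor expansion of \<open>u\<close> at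
  \<open>x\<close>, its membership here says that \<open>u\<close> vanishes to order
  \<open>l\<close> at \<open>x\<close>. Unlike iterated derivatives, this also works for
  \<open>l\<close> above the characteristic.\<close>

definition trunc_ideal :: "'a::comm_ring_1 set \<Rightarrow> nat \<Rightarrow> 'a poly set"
  where "trunc_ideal I l = {u. \<forall>k<l. coeff u k \<in> I}"

context ring_ideal
begin

lemma ring_ideal_poly_ideal: "ring_ideal (poly_ideal I)"
  by unfold_locales (auto simp: poly_ideal_def coeff_mult intro!: add_mem sum_mem mult_mem)

lemma ring_ideal_trunc_ideal: "ring_ideal (trunc_ideal I l)"
  by unfold_locales (auto simp: trunc_ideal_def coeff_mult intro!: add_mem sum_mem mult_mem)

lemma poly_ideal_pCons_iff [simp]: "pCons a u \<in> poly_ideal I \<longleftrightarrow> a \<in> I \<and> u \<in> poly_ideal I"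
  unfolding poly_ideal_def by (auto simp: coeff_pCons split: nat.splits)

lemma poly_ideal_subset_trunc_ideal: "poly_ideal I \<subseteq> trunc_ideal I l"
  by (auto simp: poly_ideal_def trunc_ideal_def)

lemma trunc_ideal_imp_poly_ideal:
  "u \<in> trunc_ideal I l \<Longrightarrow> degree u < l \<Longrightarrow> u \<in> poly_ideal I"
  by (auto simp: trunc_ideal_def poly_ideal_def) (metis coeff_eq_0 order.strict_trans2 not_less zero_mem)

lemma poly_ideal_eval: "u \<in> poly_ideal I \<Longrightarrow> poly u x \<in> I"
  by (induction u) (auto intro: add_mem mult_mem)

lemma poly_ideal_pcompose: "u \<in> poly_ideal I \<Longrightarrow> pcompose u v \<in> poly_ideal I"
proof (induction u)
  case (pCons a u)
  interpret P: ring_ideal "poly_ideal I" by (rule ring_ideal_poly_ideal)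
  show ?case
    using pCons by (auto simp: pcompose_pCons intro!: P.add_mem P.mult_mem)
qed (simp add: poly_ideal_def)

text \<open>Write \<open>u = c + X v\<close>. Frobenius gives \<open>u^q = c^q + X^q v^q\<close>,
  where \<open>c^q = c\<close> modulo \<open>I\<close> and \<open>X^q\<close> lies in the ideal
  because \<open>l \<le> q\<close>.\<close>

lemma icong_trunc_power_prime_power:
  assumes p: "prime p" "of_nat p \<in> I" and q: "q = p ^ e" and l: "l \<le> q"
    and frob: "\<And>x. x ^ q - x \<in> I"
  shows "ring_ideal.icong (trunc_ideal I l) (u ^ q) [:coeff u 0:]"
proof -
  interpret L: ring_ideal "trunc_ideal I l" by (rule ring_ideal_trunc_ideal)
  obtain c v where u: "u = pCons c v" by (cases u)
  have pI: "of_nat p \<in> trunc_ideal I l"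
    using p by (auto simp: trunc_ideal_def of_nat_poly coeff_pCons split: nat.splits)
  have "u = [:c:] + monom 1 1 * v"
    unfolding u by (simp add: monom_altdef)
  then have "L.icong (u ^ q) ([:c:] ^ q + (monom 1 1 * v) ^ q)"
    using L.icong_frobenius[OF p(1) pI] q by metis
  also have "L.icong \<dots> ([:c:] + 0)"
  proof (rule L.icong_add)
    show "L.icong ([:c:] ^ q) [:c:]"
      using frob[of c] unfolding L.icong_def
      by (auto simp: trunc_ideal_def poly_const_pow coeff_pCons split: nat.splits)
    have "(monom 1 1 * v) ^ q = monom 1 q * v ^ q"
      by (simp add: power_mult_distrib monom_power)
    then show "L.icong ((monom 1 1 * v) ^ q) 0"
      unfolding L.icong_def using l by (auto simp: trunc_ideal_def coeff_monom_mult)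
  qed
  finally show ?thesis
    by (simp add: u)
qed

end

section \<open>Prime ideals: cancellation and zeros with multiplicity\<close>

locale prime_ring_ideal = ring_ideal +
  assumes prime_mem: "a * b \<in> I \<Longrightarrow> a \<in> I \<or> b \<in> I"
    and one_not_mem: "1 \<notin> I"
begin

lemma power_memD: "a ^ k \<in> I \<Longrightarrow> a \<in> I"
  by (induction k) (auto simp: one_not_mem dest: prime_mem)

lemma prod_memD: "finite S \<Longrightarrow> prod h S \<in> I \<Longrightarrow> \<exists>x\<in>S. h x \<in> I"
  by (induction S rule: finite_induct) (auto simp: one_not_mem dest: prime_mem)

text \<open>The lowest coefficient of \<open>v\<close> outside \<open>I\<close> would survive in the
  product, multiplied by \<open>coeff u 0\<close>.\<close>

lemma trunc_ideal_cancel: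
  assumes u: "coeff u 0 \<notin> I" and uv: "u * v \<in> trunc_ideal I l"
  shows "v \<in> trunc_ideal I l"
proof -
  have "coeff v k \<in> I" if "k < l" for k
    using that
  proof (induction k rule: less_induct)
    case (less k)
    have "coeff (u * v) k = coeff u 0 * coeff v k + (\<Sum>i\<in>{1..k}. coeff u i * coeff v (k - i))"
      by (simp add: coeff_mult atMost_atLeast0 sum.atLeast_Suc_atMost)
    moreover have "coeff (u * v) k \<in> I"
      using uv less.prems by (auto simp: trunc_ideal_def)
    moreover have "(\<Sum>i\<in>{1..k}. coeff u i * coeff v (k - i)) \<in> I"
      by (rule sum_mem, rule mult_mem, rule less.IH) (use less.prems in auto)
    ultimately have "coeff u 0 * coeff v k \<in> I"
      by (metis add_diff_cancel_right' diff_mem)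
    then show ?case
      using prime_mem u by blast
  qed
  then show ?thesis
    by (simp add: trunc_ideal_def)
qed

lemma poly_ideal_cancel:
  assumes u: "coeff u 0 \<notin> I" and uv: "u * v \<in> poly_ideal I"
  shows "v \<in> poly_ideal I"
proof -
  have "v \<in> trunc_ideal I (Suc (degree v))"
    using trunc_ideal_cancel[OF u] uv poly_ideal_subset_trunc_ideal by blast
  then show ?thesis
    using trunc_ideal_imp_poly_ideal by blast
qed

text \<open>The root count with multiplicity \<open>l\<close>: each point splits off a factor
  \<open>[:-x, 1:] ^ l\<close>, and primality of \<open>I\<close> keeps the other points zeros of
  the quotient.\<close>

lemma poly_ideal_of_zeros:
  assumes "finite X" and "\<And>x y. x \<in> X \<Longrightarrow> y \<in> X \<Longrightarrow> x - y \<in> I \<Longrightarrow> x = y"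
    and "\<And>x. x \<in> X \<Longrightarrow> pcompose u [:x, 1:] \<in> trunc_ideal I l"
    and "degree u < l * card X"
  shows "u \<in> poly_ideal I"
  using assms
proof (induction X arbitrary: u rule: finite_induct)
  case (insert x X)
  interpret P: ring_ideal "poly_ideal I" by (rule ring_ideal_poly_ideal)
  interpret L: ring_ideal "trunc_ideal I l" by (rule ring_ideal_trunc_ideal)
  define w where "w = pcompose u [:x, 1:]"
  \<comment> \<open>The Taylor expansion at \<open>x\<close> is cut at order \<open>l\<close>:
    \<open>w0\<close> is congruent to zero, and \<open>w1\<close>, shifted back, is the quotient
    \<open>v\<close> by \<open>[:-x, 1:] ^ l\<close>.\<close>
  define w0 where "w0 = poly_cutoff l w"
  define w1 where "w1 = poly_shift l w"
  have w: "w = w0 + monom 1 l * w1"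
    by (rule poly_eqI) (auto simp: w0_def w1_def coeff_poly_cutoff coeff_poly_shift coeff_monom_mult)
  have w0: "w0 \<in> poly_ideal I"
    using insert.prems(2)[of x]
    by (auto simp: w0_def w_def poly_ideal_def trunc_ideal_def coeff_poly_cutoff)
  define v where "v = pcompose w1 [:-x, 1:]"
  have shift: "pcompose (pcompose z [:x, 1:]) [:-x, 1:] = z" for z :: "'a poly"
    by (simp add: pcompose_assoc[symmetric] pcompose_pCons)
  have u: "u = pcompose w0 [:-x, 1:] + [:-x, 1:] ^ l * v"
  proof -
    have "u = pcompose w [:-x, 1:]"
      by (simp add: w_def shift)
    also have "\<dots> = pcompose w0 [:-x, 1:] + pcompose (monom 1 l) [:-x, 1:] * v"
      by (subst w) (simp add: pcompose_add pcompose_mult v_def)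
    also have "pcompose (monom 1 l) [:-x, 1:] = [:-x, 1:] ^ l"
      by (simp add: monom_altdef pcompose_power pcompose_pCons)
    finally show ?thesis .
  qed
  have w0': "pcompose w0 [:-x, 1:] \<in> poly_ideal I"
    by (rule poly_ideal_pcompose[OF w0])
  have degw: "degree w \<le> degree u"
    using degree_pcompose_le[of u "[:x, 1:]"] by (simp add: w_def)
  have "v \<in> poly_ideal I"
  proof (cases "degree u < l")
    case True
    then have "w1 = 0"
      using degw by (intro poly_eqI) (simp add: w1_def coeff_poly_shift coeff_eq_0)
    then show ?thesis by (simp add: v_def)
  next
    case False
    have "degree w1 \<le> degree u - l"
      by (rule degree_le) (use degw in \<open>auto simp: w1_def coeff_poly_shift intro!: coeff_eq_0\<close>)
    then have "degree v \<le> degree u - l"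
      using degree_pcompose_le[of w1 "[:-x, 1:]"] by (simp add: v_def)
    then have deg: "degree v < l * card X"
      using insert.prems(3) insert.hyps False by simp
    have "pcompose v [:y, 1:] \<in> trunc_ideal I l" if y: "y \<in> X" for y
    proof -
      have "pcompose u [:y, 1:] - pcompose (pcompose w0 [:-x, 1:]) [:y, 1:] \<in> trunc_ideal I l"
        using insert.prems(2)[of y] y poly_ideal_pcompose[OF w0'] poly_ideal_subset_trunc_ideal
        by (intro L.diff_mem) auto
      also have "pcompose u [:y, 1:] - pcompose (pcompose w0 [:-x, 1:]) [:y, 1:]
          = [:y - x, 1:] ^ l * pcompose v [:y, 1:]"
        by (subst u) (simp add: pcompose_add pcompose_mult pcompose_power pcompose_pCons)
      finally have *: "[:y - x, 1:] ^ l * pcompose v [:y, 1:] \<in> trunc_ideal I l" .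
      \<comment> \<open>At \<open>y\<close> the split-off factor has constant term
        \<open>(y - x)^l\<close>, nonzero modulo \<open>I\<close>, so it cancels and
        \<open>v\<close> still vanishes to order \<open>l\<close>.\<close>
      have "y - x \<notin> I"
        using insert.prems(1)[of y x] y insert.hyps by auto
      then have "coeff ([:y - x, 1:] ^ l) 0 \<notin> I"
        using power_memD by (auto simp: coeff_0_power)
      then show ?thesis
        using trunc_ideal_cancel * by blast
    qed
    then show ?thesis
      using insert.IH[of v] insert.prems(1) deg by auto
  qed
  then show ?case
    by (subst u) (intro P.add_mem P.mult_mem w0')
qed simp

section \<open>Nonvanishing of the auxiliary polynomial\<close>

text \<open>The multiplicity of \<open>a\<close> as a root is odd on one side and even on the other; the proof is an
  infinite descent that divides \<open>r\<close> and \<open>s\<close> by \<open>X - a\<close>.\<close>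

lemma no_square_ratio:
  assumes a: "a \<notin> I" and c: "c \<notin> I" and f: "poly f a \<notin> I"
  shows "[:-a, 1:] * f * r\<^sup>2 - [:c:] * s\<^sup>2 \<in> poly_ideal I \<Longrightarrow> r \<in> poly_ideal I \<and> s \<in> poly_ideal I"
proof (induction "degree r + degree s" arbitrary: r s rule: less_induct)
  case less
  interpret P: ring_ideal "poly_ideal I" by (rule ring_ideal_poly_ideal)
  define l where "l = [:-a, 1:]"
  define C where "C = [:c:]"
  have prems: "l * f * r\<^sup>2 - C * s\<^sup>2 \<in> poly_ideal I"
    using less.prems by (simp only: l_def C_def)
  define r' where "r' = synthetic_div r a"
  define s' where "s' = synthetic_div s a"
  \<comment> \<open>Here \<open>a \<notin> I\<close> enters: the constant term \<open>-a\<close>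
    makes \<open>X - a\<close> cancellable.\<close>
  have l0: "coeff l 0 \<notin> I"
    using a minus_mem[of "-a"] by (auto simp: l_def)
  have r: "r = l * r' + [:poly r a:]" and s: "s = l * s' + [:poly s a:]"
    by (simp_all only: r'_def s'_def l_def synthetic_div_correct')
  have "poly (l * f * r\<^sup>2 - C * s\<^sup>2) a \<in> I"
    by (rule poly_ideal_eval[OF prems])
  then have "c * (poly s a)\<^sup>2 \<in> I"
    using minus_mem[of "- (c * (poly s a)\<^sup>2)"] by (simp add: power2_eq_square l_def C_def)
  then have sa: "poly s a \<in> I"
    using c prime_mem power_memD by blast
  then have s_cong: "P.icong s (l * s')"
    unfolding P.icong_def by (subst s) (simp add: poly_ideal_def coeff_pCons split: nat.splits)
  have "P.icong (l * (f * r\<^sup>2)) (C * s\<^sup>2)"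
    using prems by (simp add: P.icong_def mult.assoc)
  also have "P.icong \<dots> (C * (l * s')\<^sup>2)"
    by (intro P.icong_mult P.icong_power s_cong) simp
  finally have "l * (f * r\<^sup>2 - C * l * s'\<^sup>2) \<in> poly_ideal I"
    by (simp add: P.icong_def algebra_simps power2_eq_square)
  then have 1: "f * r\<^sup>2 - C * l * s'\<^sup>2 \<in> poly_ideal I"
    by (rule poly_ideal_cancel[OF l0])
  have "poly (f * r\<^sup>2 - C * l * s'\<^sup>2) a \<in> I"
    by (rule poly_ideal_eval[OF 1])
  then have "poly f a * (poly r a)\<^sup>2 \<in> I"
    by (simp add: power2_eq_square l_def C_def)
  then have ra: "poly r a \<in> I"
    using f prime_mem power_memD by blast
  then have r_cong: "P.icong r (l * r')"
    unfolding P.icong_def by (subst r) (simp add: poly_ideal_def coeff_pCons split: nat.splits)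
  have "P.icong (f * (l * r')\<^sup>2) (f * r\<^sup>2)"
    by (intro P.icong_mult P.icong_power P.icong_sym[OF r_cong]) simp
  also have "P.icong \<dots> (C * l * s'\<^sup>2)"
    using 1 by (simp add: P.icong_def)
  finally have "l * (l * f * r'\<^sup>2 - C * s'\<^sup>2) \<in> poly_ideal I"
    by (simp add: P.icong_def algebra_simps power2_eq_square)
  then have 2: "l * f * r'\<^sup>2 - C * s'\<^sup>2 \<in> poly_ideal I"
    by (rule poly_ideal_cancel[OF l0])
  have "r' \<in> poly_ideal I \<and> s' \<in> poly_ideal I"
  \<comment> \<open>For constants the degree sum cannot drop, but then both quotients are
    zero.\<close>
  proof (cases "degree r + degree s = 0")
    case True
    then have "r' = 0" "s' = 0"
      by (simp_all add: r'_def s'_def synthetic_div_eq_0_iff)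
    then show ?thesis by simp
  next
    case False
    then have "degree r' + degree s' < degree r + degree s"
      by (auto simp: r'_def s'_def degree_synthetic_div)
    then show ?thesis
      using less.hyps 2 by (simp only: l_def C_def)
  qed
  then show ?case
    using r_cong s_cong P.icong_mem_iff P.mult_mem by blast
qed

text \<open>If \<open>r + s f\<^sup>n \<equiv> 0 (mod X\<^sup>q)\<close> with \<open>2n + 1 = q\<close>, then squaring and multiplying by \<open>f\<close>
  yields \<open>f r\<^sup>2 \<equiv> f(0) s\<^sup>2\<close>, since \<open>f\<^sup>q \<equiv> f(0)\<close>; both sides have degree below \<open>q\<close>.\<close>

lemma auxiliary_block_zero:
  assumes p: "prime p" "of_nat p \<in> I" and q: "q = p ^ e" "q = 2 * n + 1"
    and frob: "\<And>x. x ^ q - x \<in> I"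
    and T: "finite T" "T \<noteq> {}" "\<And>a. a \<in> T \<Longrightarrow> a \<notin> I"
      "\<And>a b. a \<in> T \<Longrightarrow> b \<in> T \<Longrightarrow> a - b \<in> I \<Longrightarrow> a = b"
    and f: "f = (\<Prod>a\<in>T. [:-a, 1:])"
    and deg: "degree r < B" "degree s < B" "2 * B + card T \<le> q"
    and mem: "r + s * f ^ n \<in> trunc_ideal I q"
  shows "r \<in> poly_ideal I \<and> s \<in> poly_ideal I"
proof -
  interpret L: ring_ideal "trunc_ideal I q" by (rule ring_ideal_trunc_ideal)
  obtain a where a: "a \<in> T" using T by blast
  define f1 where "f1 = (\<Prod>b\<in>T - {a}. [:-b, 1:])"
  define c where "c = coeff f 0"
  have ff1: "f = [:-a, 1:] * f1"
    unfolding f f1_def by (rule prod.remove) (use T a in auto)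
  have c: "c \<notin> I"
  proof
    assume "c \<in> I"
    moreover have "c = (\<Prod>a\<in>T. - a)"
      by (simp add: c_def f poly_0_coeff_0[symmetric] poly_prod)
    ultimately obtain b where "b \<in> T" "- b \<in> I"
      using prod_memD[of T uminus] T by auto
    then show False
      using T minus_mem[of "-b"] by auto
  qed
  \<comment> \<open>Distinct elements of \<open>T\<close> are incongruent, so \<open>a\<close> is a
    simple root of \<open>f\<close>; this is the odd multiplicity that
    \<open>no_square_ratio\<close> exploits.\<close>
  have f1a: "poly f1 a \<notin> I"
  proof
    assume "poly f1 a \<in> I"
    moreover have "poly f1 a = (\<Prod>b\<in>T - {a}. a - b)"
      by (simp add: f1_def poly_prod)
    ultimately obtain b where "b \<in> T - {a}" "a - b \<in> I"
      using prod_memD[of "T - {a}" "\<lambda>b. a - b"] T by auto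
    then show False
      using T(4)[of a b] a by auto
  qed
  have degf: "degree f \<le> card T"
    unfolding f using degree_prod_sum_le[of T "\<lambda>a. [:-a, 1:]"] T by (simp add: o_def)
  have "L.icong (f * r\<^sup>2) (f ^ q * s\<^sup>2)"
  proof -
    \<comment> \<open>By \<open>q = 2 * n + 1\<close>, \<open>f ^ q\<close> is
      \<open>f * (f ^ n) ^ 2\<close>, so the difference contains the factor
      \<open>r + s * f ^ n\<close>.\<close>
    have "f * r\<^sup>2 - f ^ q * s\<^sup>2 = f * (r - s * f ^ n) * (r + s * f ^ n)"
      unfolding q(2) by (simp add: algebra_simps power2_eq_square power_add mult_2_right)
    then show ?thesis
      unfolding L.icong_def using L.mult_mem[OF mem] by metis
  qed
  also have "L.icong \<dots> ([:c:] * s\<^sup>2)"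
    unfolding c_def by (intro L.icong_mult icong_trunc_power_prime_power[OF p q(1)] frob) auto
  finally have tr: "f * r\<^sup>2 - [:c:] * s\<^sup>2 \<in> trunc_ideal I q"
    by (simp add: L.icong_def)
  have "degree (f * r\<^sup>2) \<le> degree f + (degree r * 2)"
    by (rule order.trans[OF degree_mult_le]) (simp add: degree_power_le)
  moreover have "degree ([:c:] * s\<^sup>2) \<le> degree s * 2"
    by (rule order.trans[OF degree_mult_le]) (simp add: degree_power_le)
  ultimately have "degree (f * r\<^sup>2 - [:c:] * s\<^sup>2) < q"
    using degf deg by (intro degree_diff_less) auto
  then have "f * r\<^sup>2 - [:c:] * s\<^sup>2 \<in> poly_ideal I"
    using trunc_ideal_imp_poly_ideal tr by blast
  then show ?thesis
    using no_square_ratio[OF _ c f1a] T(3)[OF a] ff1 by metis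
qed

text \<open>The blocks may overlap, as \<open>w j\<close> can have degree \<open>q\<close> or more.
  Going up from \<open>j = 0\<close>, the coefficients at positions \<open>j q\<close> to
  \<open>j q + q - 1\<close> see only \<open>w j\<close> and earlier blocks, already known to
  vanish; this puts \<open>w j\<close> in \<open>trunc_ideal I q\<close>, and \<open>block\<close>
  does the rest.\<close>

lemma block_sum_zero:
  assumes sum: "(\<Sum>j<J. w j * monom 1 (j * q)) \<in> poly_ideal I"
    and block: "\<And>j. j < J \<Longrightarrow> w j \<in> trunc_ideal I q \<Longrightarrow> w j \<in> poly_ideal I"
    and j: "j < J"
  shows "w j \<in> poly_ideal I"
  using j
proof (induction j rule: less_induct)
  case (less j)
  have "coeff (w j) i \<in> I" if i: "i < q" for i
  proof -
    have "coeff (\<Sum>j<J. w j * monom 1 (j * q)) (j * q + i)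
        = (\<Sum>j'<J. coeff (monom 1 (j' * q) * w j') (j * q + i))"
      by (simp add: coeff_sum mult.commute)
    also have "\<dots> = coeff (w j) i + (\<Sum>j'\<in>{..<J} - {j}. coeff (monom 1 (j' * q) * w j') (j * q + i))"
      using less.prems by (subst sum.remove[of _ j]) (auto simp: coeff_monom_mult)
    finally have eq: "coeff (w j) i = coeff (\<Sum>j<J. w j * monom 1 (j * q)) (j * q + i)
       - (\<Sum>j'\<in>{..<J} - {j}. coeff (monom 1 (j' * q) * w j') (j * q + i))"
      by simp
    have "coeff (monom 1 (j' * q) * w j') (j * q + i) \<in> I" if j': "j' \<in> {..<J} - {j}" for j'
    proof (cases "j' < j")
      case True
      then show ?thesis
        using less.IH[of j'] j' by (auto simp: coeff_monom_mult poly_ideal_def)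
    next
      case False
      then have "(j + 1) * q \<le> j' * q"
        using j' by (intro mult_right_mono) auto
      then have "j * q + i < j' * q"
        using i by simp
      then show ?thesis by (simp add: coeff_monom_mult)
    qed
    then show ?thesis
      unfolding eq using sum by (intro diff_mem sum_mem) (auto simp: poly_ideal_def)
  qed
  then show ?case
    using block less.prems by (simp add: trunc_ideal_def)
qed


section \<open>Stepanov's auxiliary polynomial and the resulting point count\<close>

text \<open>The bivariate polynomials in the proof have \<open>X\<close> as outer and the increment \<open>H\<close> as inner
  variable: \<open>fX = f(X)\<close>, \<open>fXH = f(X + H)\<close>, and \<open>\<epsilon> G / f(X)\<^sup>l\<close> is the binomial expansion of
  \<open>f(X + H)\<^sup>n\<close> modulo \<open>H\<^sup>l\<close> at points where \<open>f(X)\<^sup>n = \<epsilon>\<close>. Hence \<open>K = 0\<close> modulo \<open>H\<^sup>l\<close> makes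
  \<open>R\<close> vanish to order \<open>l\<close> at these points.\<close>

lemma stepanov_bound:
  fixes \<epsilon> :: 'a
  assumes p: "prime p" "of_nat p \<in> I" and q: "q = p ^ e" "q = 2 * n + 1"
    and frob: "\<And>x. x ^ q - x \<in> I"
    and C: "finite C" "card C = q" "\<And>x. \<exists>c\<in>C. x - c \<in> I"
      "\<And>a b. a \<in> C \<Longrightarrow> b \<in> C \<Longrightarrow> a - b \<in> I \<Longrightarrow> a = b"
    and T: "T \<subseteq> C" "T \<noteq> {}" "\<And>a. a \<in> T \<Longrightarrow> a \<notin> I"
    and \<epsilon>: "\<epsilon> \<notin> I"
    and m: "m = card T"
    and bounds: "2 * B + m \<le> q" "0 < B" "0 < J" "l \<le> n" "0 < n" "l * (m * l + B + J) < 2 * J * B"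
  shows "l * card {x \<in> C. (\<Prod>a\<in>T. x - a) ^ n - \<epsilon> \<in> I} \<le> B + m * n + (J - 1) * q"
proof -
  define N where "N = {x \<in> C. (\<Prod>a\<in>T. x - a) ^ n - \<epsilon> \<in> I}"
  interpret P: ring_ideal "poly_ideal I" by (rule ring_ideal_poly_ideal)
  interpret L: ring_ideal "trunc_ideal I l" by (rule ring_ideal_trunc_ideal)
  have finT: "finite T"
    using T C finite_subset by blast
  define f where "f = (\<Prod>a\<in>T. [:-a, 1:])"
  define D where "D = m * l + B + J"
  define fX where "fX = (\<Prod>a\<in>T. [:[:-a:], 1:])"
  define fXH where "fXH = (\<Prod>a\<in>T. [:[:-a, 1:], 1:])"
  define G where "G = (\<Sum>i<l. of_nat (n choose i) * fX ^ (l - i) * (fXH - fX) ^ i)"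
  \<comment> \<open>The share of one index pair in \<open>f(X)^l R(X + H)\<close> after two
    replacements: \<open>\<epsilon> G\<close> for \<open>f(X)^l f(X + H)^n\<close>, and
    \<open>X^j\<close> for \<open>(X + H)^(j q)\<close>, congruent to it modulo \<open>H^l\<close>
    at field points. The flag selects the coefficient of \<open>r j\<close> or of
    \<open>s j\<close>, and \<open>[:[:0, 1:], 1:]\<close> is \<open>X + H\<close>.\<close>
  define Q where "Q c j i = ([:[:c (j, i, False):]:] * fX ^ l + [:[:\<epsilon> * c (j, i, True):]:] * G)
      * [:[:0, 1:], 1:] ^ i * [:0, 1:] ^ j" for c :: "nat \<times> nat \<times> bool \<Rightarrow> 'a" and j i
  define K where "K c = (\<Sum>j<J. \<Sum>i<B. Q c j i)" for c :: "nat \<times> nat \<times> bool \<Rightarrow> 'a"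
  have degfX: "degree fX \<le> m" and degfXH: "degree fXH \<le> m"
    unfolding fX_def fXH_def m
    using degree_prod_sum_le[OF finT, of "\<lambda>a. [:[:-a:], 1:]"]
      degree_prod_sum_le[OF finT, of "\<lambda>a. [:[:-a, 1:], 1:]"] by (simp_all add: o_def)
  have degpow: "degree (z ^ k) \<le> d * k" if "degree z \<le> d" for z :: "'a poly poly" and k d
    using degree_power_le[of z k] that by (meson mult_le_mono1 order.trans)
  have degmult: "degree (y * z) \<le> c + d" if "degree y \<le> c" "degree z \<le> d"
    for y z :: "'a poly poly" and c d
    using degree_mult_le[of y z] that by linarith
  have degG: "degree G \<le> m * l"
    unfolding G_def
  proof (rule degree_sum_le)
    fix i assume i: "i \<in> {..<l}"
    have "degree (of_nat (n choose i) * fX ^ (l - i) * (fXH - fX) ^ i) \<le> 0 + m * (l - i) + m * i"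
      using degfX degfXH by (intro degmult degpow degree_diff_le) auto
    also have "\<dots> = m * l"
      using i by (simp add: algebra_simps flip: distrib_left)
    finally show "degree (of_nat (n choose i) * fX ^ (l - i) * (fXH - fX) ^ i) \<le> m * l" .
  qed simp
  have degK: "degree (K c) < D" for c
  proof -
    have "degree (Q c j i) \<le> m * l + (B - 1) + (J - 1)" if "j < J" "i < B" for i j
    proof -
      have "degree (Q c j i) \<le> (0 + m * l) + 1 * i + 1 * j"
        unfolding Q_def
        by (intro degmult degpow degree_add_le degG degfX) auto
      then show ?thesis
        using that by linarith
    qed
    then have "degree (K c) \<le> m * l + (B - 1) + (J - 1)"
      unfolding K_def by (intro degree_sum_le) auto
    then show ?thesis
      using bounds by (simp add: D_def)
  qed
  have K_diff: "K (\<lambda>x. c x - d x) = K c - K d" for c d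
  proof -
    have "Q (\<lambda>x. c x - d x) j i = Q c j i - Q d j i" for j i
    proof -
      have "[:[:a - b:]:] = [:[:a:]:] - [:[:b:]:]" for a b :: 'a
        by simp
      then show ?thesis
        unfolding Q_def right_diff_distrib by (simp only: left_diff_distrib distrib_right) simp
    qed
    then show ?thesis
      by (simp add: K_def sum_subtractf)
  qed
  \<comment> \<open>Representatives in \<open>C\<close> turn residues into elements of a finite set,
    ready for the pigeonhole principle.\<close>
  define rep where "rep x = (SOME c. c \<in> C \<and> x - c \<in> I)" for x
  have rep: "rep x \<in> C" "x - rep x \<in> I" for x
    using someI_ex[of "\<lambda>c. c \<in> C \<and> x - c \<in> I"] C(3)[of x] unfolding rep_def by blast+
  let ?Idx = "{..<J} \<times> {..<B} \<times> (UNIV :: bool set)"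
  let ?V = "?Idx \<rightarrow>\<^sub>E C"
  let ?W = "({..<D} \<times> {..<l}) \<rightarrow>\<^sub>E C"
  define \<Phi> where "\<Phi> c = restrict (\<lambda>(i, k). rep (coeff (coeff (K c) i) k)) ({..<D} \<times> {..<l})" for c
  have q1: "q > 1"
    using bounds q by simp
  \<comment> \<open>There are \<open>2 J B\<close> unknowns against \<open>D l\<close> conditions,
    one for each coefficient of \<open>K c\<close> of degree below \<open>D\<close> in
    \<open>X\<close> and below \<open>l\<close> in \<open>H\<close>. Two choices of unknowns thus
    give the same residues, and their difference \<open>g\<close> solves the system.\<close>
  have "\<Phi> ` ?V \<subseteq> ?W"
    using rep(1) by (auto simp: \<Phi>_def split: if_splits)
  then have "card (\<Phi> ` ?V) \<le> card ?W"
    using C by (intro card_mono) (auto intro!: finite_PiE)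
  also have "\<dots> = q ^ (D * l)"
    using C by (simp add: card_PiE)
  also have "\<dots> < q ^ (2 * J * B)"
    using bounds q1 by (intro power_strict_increasing) (simp_all add: D_def mult.commute)
  also have "\<dots> = card ?V"
    using C by (simp add: card_PiE card_cartesian_product mult_ac)
  finally have "\<not> inj_on \<Phi> ?V"
    by (rule pigeonhole)
  then obtain c d where cd: "c \<in> ?V" "d \<in> ?V" "\<Phi> c = \<Phi> d" "c \<noteq> d"
    by (auto simp: inj_on_def)
  define g where "g = (\<lambda>x. c x - d x)"
  have "K g \<in> poly_ideal (trunc_ideal I l)"
  proof -
    have "coeff (coeff (K g) i) k \<in> I" if k: "k < l" for i k
    proof (cases "i < D")
      case True
      have "rep (coeff (coeff (K c) i) k) = rep (coeff (coeff (K d) i) k)"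
        using fun_cong[OF cd(3), of "(i, k)"] k True by (simp add: \<Phi>_def)
      then have "coeff (coeff (K c) i) k - coeff (coeff (K d) i) k \<in> I"
        using diff_mem[OF rep(2)[of "coeff (coeff (K c) i) k"] rep(2)[of "coeff (coeff (K d) i) k"]]
        by simp
      then show ?thesis
        by (simp add: g_def K_diff)
    next
      case False
      then show ?thesis
        using degK[of g] by (simp add: coeff_eq_0)
    qed
    then show ?thesis
      by (simp add: poly_ideal_def trunc_ideal_def)
  qed
  then have K_eval: "poly (K g) [:x:] \<in> trunc_ideal I l" for x
    by (rule L.poly_ideal_eval)
  define r where "r j = (\<Sum>i<B. monom (g (j, i, False)) i)" for j
  define s where "s j = (\<Sum>i<B. monom (g (j, i, True)) i)" for j
  define R where "R = (\<Sum>j<J. (r j + s j * f ^ n) * monom 1 (j * q))"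
  have degr: "degree (r j) \<le> B - 1" and degs: "degree (s j) \<le> B - 1" for j
    unfolding r_def s_def
    by (auto intro!: degree_sum_le order.trans[OF degree_monom_le])
  have degf: "degree f \<le> m"
    unfolding f_def m using degree_prod_sum_le[OF finT, of "\<lambda>a. [:-a, 1:]"] by (simp add: o_def)
  \<comment> \<open>Otherwise the two preceding lemmas force every value of \<open>g\<close> into
    \<open>I\<close>, so that \<open>c\<close> and \<open>d\<close> agree as elements of
    \<open>C\<close>.\<close>
  have R_nonzero: "R \<notin> poly_ideal I"
  proof
    assume R: "R \<in> poly_ideal I"
    have block: "r j \<in> poly_ideal I \<and> s j \<in> poly_ideal I"
      if "r j + s j * f ^ n \<in> trunc_ideal I q" for j
      using auxiliary_block_zero[OF p q frob finT T(2,3) _ f_def _ _ _ that, of B] C(4) T(1)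
        degr[of j] degs[of j] bounds m by (fastforce simp: less_eq_Suc_le)
    have "r j + s j * f ^ n \<in> poly_ideal I" if "j < J" for j
      by (rule block_sum_zero[OF R[unfolded R_def] _ that]) (use block P.add_mem P.mult_mem_right in blast)
    then have rs: "r j \<in> poly_ideal I" "s j \<in> poly_ideal I" if "j < J" for j
      using block that poly_ideal_subset_trunc_ideal by blast+
    have "g (j, i, b) \<in> I" if "j < J" "i < B" for j i b
    proof -
      have "coeff (r j) i = g (j, i, False)" "coeff (s j) i = g (j, i, True)"
        using that by (simp_all add: r_def s_def coeff_sum)
      then show ?thesis
        using rs[of j] that by (cases b) (auto simp: poly_ideal_def dest: spec[of _ i])
    qed
    then have "c x = d x" if "x \<in> ?Idx" for x
      using that cd(1,2) C(4)[of "c x" "d x"] by (force simp: g_def)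
    then show False
      using cd PiE_ext by blast
  qed
  have "pcompose R [:x, 1:] \<in> trunc_ideal I l" if x: "x \<in> N" for x
  proof -
    define y where "y = (\<Prod>a\<in>T. x - a)"
    define F where "F = (\<Prod>a\<in>T. [:x - a, 1:])"
    define Gx where "Gx = (\<Sum>i<l. of_nat (n choose i) * [:y:] ^ (l - i) * (F - [:y:]) ^ i)"
    have y\<epsilon>: "y ^ n - \<epsilon> \<in> I"
      using x by (simp add: N_def y_def)
    have y: "y \<notin> I"
    proof
      assume "y \<in> I"
      then have "y ^ n \<in> I"
        using \<open>0 < n\<close> by (cases n) (auto intro: mult_mem_right)
      then show False
        using y\<epsilon> \<epsilon> mem_iff_of_diff_mem by blast
    qed
    have y\<epsilon>': "L.icong ([:y:] ^ n) [:\<epsilon>:]"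
      using y\<epsilon> unfolding L.icong_def by (auto simp: trunc_ideal_def poly_const_pow coeff_pCons split: nat.splits)
    obtain F' where F': "F - [:y:] = monom 1 1 * F'"
    proof -
      obtain b v where bv: "F - [:y:] = pCons b v" by (cases "F - [:y:]")
      have "b = poly (F - [:y:]) 0"
        by (simp add: bv)
      also have "\<dots> = 0"
        by (simp add: F_def y_def poly_prod)
      finally have "F - [:y:] = monom 1 1 * v"
        unfolding bv by (simp add: monom_altdef)
      then show ?thesis by (rule that)
    qed
    have high: "(F - [:y:]) ^ i \<in> trunc_ideal I l" if "l \<le> i" for i
    proof -
      have "(F - [:y:]) ^ i = monom 1 i * F' ^ i"
        by (simp add: F' power_mult_distrib monom_power)
      then show ?thesis
        using that by (auto simp: trunc_ideal_def coeff_monom_mult)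
    qed
    \<comment> \<open>The factor \<open>y^l\<close> avoids negative powers:
      \<open>y^(l + n - i) = y^n y^(l - i)\<close> becomes \<open>\<epsilon> y^(l - i)\<close>, and
      the terms with \<open>i \<ge> l\<close> vanish because \<open>F - y\<close> is divisible by
      \<open>H\<close>.\<close>
    have main: "L.icong ([:y:] ^ l * F ^ n) ([:\<epsilon>:] * Gx)"
    proof -
      let ?t = "\<lambda>i. [:y:] ^ l * (of_nat (n choose i) * (F - [:y:]) ^ i * [:y:] ^ (n - i))"
      have "[:y:] ^ l * F ^ n = [:y:] ^ l * ((F - [:y:]) + [:y:]) ^ n"
        by simp
      also have "\<dots> = (\<Sum>i\<le>n. ?t i)"
        by (simp only: binomial_ring sum_distrib_left)
      also have "\<dots> = (\<Sum>i<l. ?t i) + (\<Sum>i\<in>{l..n}. ?t i)"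
        using \<open>l \<le> n\<close> by (subst sum.union_disjoint[symmetric]) (auto intro!: sum.cong)
      finally have expand: "[:y:] ^ l * F ^ n = (\<Sum>i<l. ?t i) + (\<Sum>i\<in>{l..n}. ?t i)" .
      have "L.icong ((\<Sum>i<l. ?t i) + (\<Sum>i\<in>{l..n}. ?t i)) ((\<Sum>i<l. [:\<epsilon>:] * (of_nat (n choose i) * [:y:] ^ (l - i) * (F - [:y:]) ^ i)) + 0)"
      proof (intro L.icong_add L.icong_sum)
        show "L.icong (\<Sum>i\<in>{l..n}. ?t i) 0"
          unfolding L.icong_def diff_0_right by (rule L.sum_mem, rule L.mult_mem, rule L.mult_mem_right, rule L.mult_mem, rule high) simp
        fix i assume i: "i \<in> {..<l}"
        have "?t i = [:y:] ^ (l + (n - i)) * (of_nat (n choose i) * (F - [:y:]) ^ i)"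
          by (simp only: power_add mult_ac)
        also have "l + (n - i) = n + (l - i)"
          using i \<open>l \<le> n\<close> by simp
        also have "[:y:] ^ (n + (l - i)) * (of_nat (n choose i) * (F - [:y:]) ^ i)
            = [:y:] ^ n * (of_nat (n choose i) * [:y:] ^ (l - i) * (F - [:y:]) ^ i)"
          by (simp only: power_add mult_ac)
        finally have t: "?t i = [:y:] ^ n * (of_nat (n choose i) * [:y:] ^ (l - i) * (F - [:y:]) ^ i)" .
        show "L.icong (?t i) ([:\<epsilon>:] * (of_nat (n choose i) * [:y:] ^ (l - i) * (F - [:y:]) ^ i))"
          unfolding t by (rule L.icong_mult[OF y\<epsilon>' L.icong_refl])
      qed
      then show ?thesis
        unfolding expand by (simp only: Gx_def sum_distrib_left add_0_right)
    qed
    have xq: "L.icong ([:x, 1:] ^ (j * q)) ([:x:] ^ j)" for j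
      using L.icong_power[OF icong_trunc_power_prime_power[OF p q(1) _ frob, of l "[:x, 1:]"], of j]
        bounds q by (simp add: mult.commute[of j] power_mult)
    define u where "u j i = [:g (j, i, False):] * [:x, 1:] ^ i" for j i
    define v where "v j i = [:g (j, i, True):] * [:x, 1:] ^ i" for j i
    have comp_r: "pcompose (r j) [:x, 1:] = (\<Sum>i<B. u j i)"
      and comp_s: "pcompose (s j) [:x, 1:] = (\<Sum>i<B. v j i)" for j
      by (simp_all add: r_def s_def u_def v_def pcompose_sum monom_altdef pcompose_smult
          pcompose_power pcompose_pCons)
    have comp_f: "pcompose f [:x, 1:] = F"
      by (simp add: f_def F_def pcompose_prod pcompose_pCons)
    have comp_mon: "pcompose (monom 1 k) [:x, 1:] = [:x, 1:] ^ k" for k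
      by (simp add: monom_altdef pcompose_power pcompose_pCons)
    have "[:y:] ^ l * pcompose R [:x, 1:]
        = (\<Sum>j<J. [:y:] ^ l * (((\<Sum>i<B. u j i) + (\<Sum>i<B. v j i) * F ^ n) * [:x, 1:] ^ (j * q)))"
      by (simp only: R_def pcompose_sum pcompose_add pcompose_mult pcompose_power comp_r comp_s
          comp_f comp_mon sum_distrib_left)
    also have "\<dots> = (\<Sum>j<J. \<Sum>i<B. (u j i * [:y:] ^ l + v j i * ([:y:] ^ l * F ^ n)) * [:x, 1:] ^ (j * q))"
    proof -
      have "Y * ((U + V * W) * Z) = (U * Y + V * (Y * W)) * Z" for U V W Y Z :: "'a poly"
        by (simp add: algebra_simps)
      then show ?thesis
        by (simp only: sum_distrib_right[symmetric] sum.distrib)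
    qed
    finally have "L.icong ([:y:] ^ l * pcompose R [:x, 1:])
        (\<Sum>j<J. \<Sum>i<B. (u j i * [:y:] ^ l + v j i * ([:\<epsilon>:] * Gx)) * [:x:] ^ j)"
      by (simp only:) (intro L.icong_sum L.icong_mult L.icong_add main xq L.icong_refl)
    moreover have "\<dots> = poly (K g) [:x:]"
    proof -
      have "poly G [:x:] = Gx" "poly fX [:x:] = [:y:]"
      proof -
        show 1: "poly fX [:x:] = [:y:]"
          unfolding fX_def y_def by (simp add: poly_prod) (induction T rule: infinite_finite_induct; simp)
        have 2: "poly fXH [:x:] = F"
          unfolding fXH_def F_def by (simp add: poly_prod)
        show "poly G [:x:] = Gx"
          by (simp add: G_def Gx_def poly_sum 1 2)
      qed
      then have "poly (Q g j i) [:x:] = (u j i * [:y:] ^ l + v j i * ([:\<epsilon>:] * Gx)) * [:x:] ^ j" for j i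
        by (simp add: Q_def u_def v_def algebra_simps)
      then show ?thesis
        by (simp add: K_def poly_sum)
    qed
    ultimately have "[:y:] ^ l * pcompose R [:x, 1:] \<in> trunc_ideal I l"
      using L.icong_mem_iff K_eval by metis
    moreover have "coeff ([:y:] ^ l) 0 \<notin> I"
      using y power_memD by (auto simp: coeff_0_power)
    ultimately show ?thesis
      using trunc_ideal_cancel by blast
  qed
  then have "\<not> degree R < l * card N"
    using poly_ideal_of_zeros[of N R l] R_nonzero C by (auto simp: N_def)
  moreover have "degree R \<le> B + m * n + (J - 1) * q"
    unfolding R_def
  proof (rule degree_sum_le)
    fix j assume "j \<in> {..<J}"
    then have j: "j * q \<le> (J - 1) * q" by (intro mult_right_mono) auto
    have "degree (s j * f ^ n) \<le> (B - 1) + m * n"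
      using degree_mult_le[of "s j" "f ^ n"] degree_power_le[of f n] degs[of j] degf
        mult_right_mono[OF degf, of n] by linarith
    then have "degree (r j + s j * f ^ n) \<le> B + m * n"
      using degr[of j] by (intro degree_add_le) auto
    moreover have "degree (monom (1::'a) (j * q)) \<le> (J - 1) * q"
      using degree_monom_le[of "1::'a" "j * q"] j by linarith
    ultimately show "degree ((r j + s j * f ^ n) * monom 1 (j * q)) \<le> B + m * n + (J - 1) * q"
      using degree_mult_le[of "r j + s j * f ^ n" "monom 1 (j * q)"] by linarith
  qed simp
  ultimately show ?thesis
    by (simp add: N_def)
qed

end

subsection \<open>The quadratic character\<close>

context field
begin

lemma add_pow_0_int: "[(0::int)] \<cdot> a = \<zero>"
  by (simp add: add_pow_int_ge)

text \<open>In Horner form, the ring homomorphism from the integer polynomials that sends the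
  variable to \<open>a\<close>, for \<open>a\<close> in the carrier.\<close>

definition int_poly_eval :: "'a \<Rightarrow> int poly \<Rightarrow> 'a"
  where "int_poly_eval a u = fold_coeffs (\<lambda>c x. ([c] \<cdot> \<one>) \<oplus> a \<otimes> x) u \<zero>"

lemma int_poly_eval_0 [simp]: "int_poly_eval a 0 = \<zero>"
  by (simp add: int_poly_eval_def)

lemma int_poly_eval_pCons:
  "a \<in> carrier R \<Longrightarrow> int_poly_eval a (pCons c u) = ([c] \<cdot> \<one>) \<oplus> a \<otimes> int_poly_eval a u"
  by (cases "c = 0 \<and> u = 0") (auto simp: int_poly_eval_def add_pow_0_int)

lemma int_poly_eval_closed [simp]: "a \<in> carrier R \<Longrightarrow> int_poly_eval a u \<in> carrier R"
  by (induction u) (simp_all add: int_poly_eval_pCons)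

lemma int_poly_eval_add:
  "a \<in> carrier R \<Longrightarrow> int_poly_eval a (u + v) = int_poly_eval a u \<oplus> int_poly_eval a v"
proof (induction u v rule: poly_induct2)
  case (pCons c u d v)
  have "add_pow R (c + d) \<one> = ([c] \<cdot> \<one>) \<oplus> ([d] \<cdot> \<one>)"
    by (simp add: add.int_pow_mult)
  then show ?case
    using pCons by (simp add: int_poly_eval_pCons r_distr a_ac)
qed simp

lemma int_poly_eval_smult:
  "a \<in> carrier R \<Longrightarrow> int_poly_eval a (smult c u) = ([c] \<cdot> \<one>) \<otimes> int_poly_eval a u"
proof (induction u)
  case (pCons d u)
  have "add_pow R (c * d) \<one> = ([c] \<cdot> \<one>) \<otimes> ([d] \<cdot> \<one>)"
    by (simp add: add_pow_ldistr_int add.int_pow_pow mult.commute)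
  then show ?case
    using pCons by (simp add: int_poly_eval_pCons r_distr m_lcomm)
qed simp

lemma int_poly_eval_mult:
  "a \<in> carrier R \<Longrightarrow> int_poly_eval a (u * v) = int_poly_eval a u \<otimes> int_poly_eval a v"
  by (induction u)
    (simp_all add: int_poly_eval_add int_poly_eval_smult int_poly_eval_pCons l_distr m_assoc add_pow_0_int)

text \<open>The multiplicative group of a finite field is cyclic; evaluation at a generator reaches
  every nonzero element through the monomials alone.\<close>

lemma int_poly_surjection:
  assumes fin: "finite (carrier R)"
  obtains h :: "int poly \<Rightarrow> 'a" where "\<And>u. h u \<in> carrier R" "h 0 = \<zero>" "h 1 = \<one>"
    "\<And>u v. h (u + v) = h u \<oplus> h v" "\<And>u v. h (u * v) = h u \<otimes> h v" "range h = carrier R"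
proof -
  obtain a where a: "a \<in> carrier (mult_of R)"
    and gen: "carrier (mult_of R) = {a [^]\<^bsub>mult_of R\<^esub> i | i::nat. i \<in> UNIV}"
    using finite_field_mult_group_has_gen[OF fin] by (auto simp: nat_pow_mult_of)
  have aR: "a \<in> carrier R" using a by simp
  define h where "h = int_poly_eval a"
  have one: "h 1 = \<one>"
    using aR by (simp add: h_def one_pCons int_poly_eval_pCons)
  have pow: "h (monom 1 i) = a [^] i" for i :: nat
    using aR one
    by (induction i) (simp_all add: monom_Suc h_def int_poly_eval_pCons m_comm one_pCons[symmetric] add_pow_0_int)
  have "carrier R \<subseteq> range h"
  proof
    fix x assume x: "x \<in> carrier R"
    show "x \<in> range h"
    proof (cases "x = \<zero>")
      case True
      then have "x = h 0" by (simp add: h_def)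
      then show ?thesis by blast
    next
      case False
      then obtain i :: nat where "x = a [^] i"
        using x gen by (auto simp: nat_pow_mult_of)
      then have "x = h (monom 1 i)" by (simp add: pow)
      then show ?thesis by blast
    qed
  qed
  then have "range h = carrier R"
    using aR by (auto simp: h_def)
  then show ?thesis
    using that[of h] aR one
    by (simp add: h_def int_poly_eval_add int_poly_eval_mult)
qed

end

section \<open>The quadratic character and Euler's criterion\<close>

definition qchar :: "('a, 'm) ring_scheme \<Rightarrow> 'a \<Rightarrow> real"
  where "qchar R a = (if a = \<zero>\<^bsub>R\<^esub> then 0 else if nonzero_square R a then 1 else - 1)"

text \<open>Writing \<open>q = 2 * n + 1\<close> with \<open>n\<close> odd encodes
  \<open>q mod 4 = 3\<close>; \<open>n\<close> is the exponent in Euler's criterion.\<close>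

locale paley_field = field R for R (structure) +
  fixes q n :: nat
  assumes fin: "finite (carrier R)" and card_carrier: "card (carrier R) = q"
    and primepow_q: "primepow q" and q_eq: "q = 2 * n + 1" and odd_n: "odd n"
begin

lemma n_pos: "0 < n"
  using odd_n by (cases n) auto

lemma pow_double_n: "a \<in> carrier R \<Longrightarrow> a \<noteq> \<zero> \<Longrightarrow> a [^] (2 * n) = \<one>"
proof -
  assume a: "a \<in> carrier R" "a \<noteq> \<zero>"
  interpret M: group "mult_of R" by (rule field_mult_group)
  have "order (mult_of R) = 2 * n"
    using order_mult_of[OF fin] card_carrier q_eq by (simp add: order_def)
  then show ?thesis
    using M.pow_order_eq_1[of a] a by (simp add: nat_pow_mult_of)
qed

lemma pow_q: "a \<in> carrier R \<Longrightarrow> a [^] q = a"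
proof (cases "a = \<zero>")
  case True
  then show ?thesis by (simp add: q_eq)
next
  case False
  assume "a \<in> carrier R"
  then show ?thesis
    using pow_double_n[of a] False by (simp add: q_eq)
qed

text \<open>The order \<open>q\<close> of the additive group kills \<open>\<one>\<close>, but in
  characteristic two an odd multiple of \<open>\<one>\<close> is \<open>\<one>\<close>.\<close>

lemma two_ne_zero: "\<one> \<oplus> \<one> \<noteq> \<zero>"
proof
  assume two: "\<one> \<oplus> \<one> = \<zero>"
  have "[q] \<cdot> \<one> = \<zero>"
    using add.pow_order_eq_1[of \<one>] card_carrier by (simp add: order_def add_pow_def)
  moreover have "add_pow R (2 * k + 1) \<one> = \<one>" for k :: nat
    by (induction k) (simp_all add: a_assoc two)
  ultimately show False
    by (simp add: q_eq)
qed

lemma one_ne_minus_one: "\<one> \<noteq> \<ominus> \<one>"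
  using two_ne_zero by (metis one_closed r_neg)

lemma pow_n_cases:
  assumes "a \<in> carrier R" "a \<noteq> \<zero>"
  shows "a [^] n = \<one> \<or> a [^] n = \<ominus> \<one>"
proof -
  have "(a [^] n) \<otimes> (a [^] n) = \<one>"
    using pow_double_n[OF assms] assms by (simp add: nat_pow_mult mult_2)
  then show ?thesis
    using assms square_eq_one by blast
qed

text \<open>As \<open>n\<close> is odd, \<open>a\<^sup>n = 1\<close> exhibits \<open>a = a\<^sup>n\<^sup>+\<^sup>1\<close> as a square.\<close>

lemma nonzero_square_iff:
  assumes a: "a \<in> carrier R" "a \<noteq> \<zero>"
  shows "nonzero_square R a \<longleftrightarrow> a [^] n = \<one>"
proof
  assume "nonzero_square R a"
  then obtain z where z: "z \<in> carrier R" "a = z [^] (2::nat)"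
    by (auto simp: nonzero_square_def)
  then have "z \<noteq> \<zero>" using a by (auto simp: numeral_2_eq_2)
  then show "a [^] n = \<one>"
    using z pow_double_n[of z] by (simp add: nat_pow_pow)
next
  assume 1: "a [^] n = \<one>"
  obtain k where k: "n = 2 * k + 1" using odd_n by (elim oddE)
  have "(a [^] (k + 1)) [^] (2::nat) = a [^] (n + 1)"
    using a k by (simp only: nat_pow_pow) (simp add: algebra_simps)
  also have "\<dots> = a" using a 1 by simp
  finally show "nonzero_square R a"
    using a unfolding nonzero_square_def by (metis nat_pow_closed)
qed

lemma qchar_eq_iff:
  assumes a: "a \<in> carrier R"
  shows "qchar R a = 1 \<longleftrightarrow> a [^] n = \<one>" and "qchar R a = - 1 \<longleftrightarrow> a [^] n = \<ominus> \<one>"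
proof -
  have *: "\<zero> [^] n = \<zero>" using n_pos by (simp add: nat_pow_zero)
  have "\<ominus> \<one> \<noteq> \<zero>" "\<zero> \<noteq> \<ominus> \<one>"
    by (metis minus_zero minus_minus one_closed one_not_zero)+
  then show "qchar R a = 1 \<longleftrightarrow> a [^] n = \<one>" "qchar R a = - 1 \<longleftrightarrow> a [^] n = \<ominus> \<one>"
    using nonzero_square_iff[of a] pow_n_cases[of a] a one_ne_minus_one *
    by (auto simp: qchar_def)
qed

lemma qchar_cases: "qchar R a \<in> {-1, 0, 1}"
  by (simp add: qchar_def)

lemma qchar_eq_0_iff: "qchar R a = 0 \<longleftrightarrow> a = \<zero>"
  by (simp add: qchar_def)

lemma qchar_zero [simp]: "qchar R \<zero> = 0"
  by (simp add: qchar_def)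

lemma qchar_one [simp]: "qchar R \<one> = 1"
  using qchar_eq_iff(1)[of \<one>] by simp

lemma qchar_mult:
  assumes a: "a \<in> carrier R" and b: "b \<in> carrier R"
  shows "qchar R (a \<otimes> b) = qchar R a * qchar R b"
proof (cases "a = \<zero> \<or> b = \<zero>")
  case True
  then show ?thesis using a b by auto
next
  case False
  have "(a \<otimes> b) [^] n = (a [^] n) \<otimes> (b [^] n)"
    using a b by (simp add: nat_pow_distrib)
  moreover have "\<ominus> \<one> \<otimes> \<ominus> \<one> = \<one>"
    by (simp add: l_minus)
  ultimately show ?thesis
    using False a b pow_n_cases[of a] pow_n_cases[of b] qchar_eq_iff[of a] qchar_eq_iff[of b]
      qchar_eq_iff[of "a \<otimes> b"] by (auto simp: l_minus)
qed

text \<open>As \<open>n\<close> is odd, \<open>(-1)^n = -1\<close>, so Euler's criterion makes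
  \<open>-1\<close> a nonsquare.\<close>

lemma qchar_minus: "a \<in> carrier R \<Longrightarrow> qchar R (\<ominus> a) = - qchar R a"
proof -
  assume a: "a \<in> carrier R"
  have "(\<ominus> \<one>) [^] (2 * k + 1) = \<ominus> \<one>" for k :: nat
    by (induction k) (simp_all add: l_minus)
  then have "(\<ominus> \<one>) [^] n = \<ominus> \<one>"
    using odd_n by (elim oddE) simp
  then have "qchar R (\<ominus> \<one>) = - 1"
    by (simp add: qchar_eq_iff)
  then show ?thesis
    using qchar_mult[of "\<ominus> \<one>" a] a by (simp add: l_minus)
qed


section \<open>The weak Weil bound for products of shifted characters\<close>

text \<open>\<open>515 / 1024\<close> exceeds one half by only \<open>3 / 1024\<close>, which is
  sharp enough for \<open>product_sum_bound\<close>; that lemma also arranges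
  \<open>\<zero> \<notin> T\<close> by a translation.\<close>

lemma product_count_bound:
  assumes T: "T \<subseteq> carrier R" "T \<noteq> {}" "\<zero> \<notin> T" and small: "1000000 * (card T)\<^sup>2 \<le> q"
    and \<epsilon>: "\<epsilon> = 1 \<or> \<epsilon> = - 1"
  shows "1024 * card {y \<in> carrier R. (\<Prod>a\<in>T. qchar R (y \<ominus> a)) = \<epsilon>} \<le> 515 * q"
proof -
  obtain h :: "int poly \<Rightarrow> 'a" where closed [simp]: "\<And>u. h u \<in> carrier R"
    and h0: "h 0 = \<zero>" and h1: "h 1 = \<one>" and add: "\<And>u v. h (u + v) = h u \<oplus> h v"
    and mult: "\<And>u v. h (u * v) = h u \<otimes> h v" and surj: "range h = carrier R"
    using int_poly_surjection[OF fin] by metis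
  define I where "I = {u. h u = \<zero>}"
  have minus: "h (- u) = \<ominus> h u" for u
  proof -
    have "h (- u) \<oplus> h u = \<zero>"
      by (simp add: add[symmetric] h0)
    then show ?thesis
      by (metis closed minus_equality)
  qed
  have diff: "h (u - v) = h u \<ominus> h v" for u v
    using add[of u "- v"] by (simp add: minus minus_eq)
  have pow: "h (u ^ k) = h u [^] k" for u k
    by (induction k) (simp_all add: h1 mult m_comm)
  interpret I: prime_ring_ideal I
  proof
    fix u v
    show "u * v \<in> I \<Longrightarrow> u \<in> I \<or> v \<in> I"
      using integral[of "h u" "h v"] by (simp add: I_def mult)
  qed (auto simp: I_def h0 h1 add mult)
  define \<sigma> where "\<sigma> = inv_into UNIV h"
  have \<sigma>: "h (\<sigma> x) = x" if "x \<in> carrier R" for x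
    unfolding \<sigma>_def using that surj by (simp add: f_inv_into_f)
  have inj: "inj_on \<sigma> (carrier R)"
    by (rule inj_on_inverseI[of _ h]) (rule \<sigma>)
  obtain p e where pe: "prime p" "q = p ^ e"
    using primepow_q by (auto simp: primepow_def)
  have of_nat: "h (of_nat k) = [k] \<cdot> \<one>" for k
    by (induction k) (simp_all add: h0 h1 add a_comm)
  have "[q] \<cdot> \<one> = \<zero>"
    using add.pow_order_eq_1[of \<one>] card_carrier by (simp add: order_def add_pow_def)
  then have "of_nat p ^ e \<in> I"
    using of_nat[of q] by (simp add: I_def pe)
  then have pI: "of_nat p \<in> I"
    by (rule I.power_memD)
  define m where "m = card T"
  define B where "B = (q - m) div 2"
  define C where "C = \<sigma> ` carrier R"
  have m: "m \<ge> 1"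
    using T fin finite_subset by (fastforce simp: m_def Suc_le_eq card_gt_0_iff)
  have mm: "m \<le> m\<^sup>2" "1 \<le> m\<^sup>2"
    using m by (simp_all add: power2_eq_square)
  have small': "1000000 * m\<^sup>2 \<le> q"
    using small by (simp add: m_def)
  have B2: "2 * B + m + 1 \<ge> q" "2 * B + m \<le> q"
  proof -
    have "m \<le> q" using mm small' by linarith
    moreover have "2 * (k div 2) \<le> k" "k \<le> 2 * (k div 2) + 1" for k :: nat
      by presburger+
    ultimately show "2 * B + m + 1 \<ge> q" "2 * B + m \<le> q"
      unfolding B_def by (metis add.assoc add.commute add_le_mono1 le_add_diff_inverse2)+
  qed
  define \<delta> :: "int poly" where "\<delta> = (if \<epsilon> = 1 then 1 else - 1)"
  have h\<delta>: "h \<delta> \<noteq> \<zero>" "h \<delta> = (if \<epsilon> = 1 then \<one> else \<ominus> \<one>)"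
    using one_not_zero by (auto simp: \<delta>_def h1 minus)
  \<comment> \<open>Stepanov's bound with \<open>l = 512 m\<close>, \<open>J = 257 m\<close> and the
    largest \<open>B\<close> with \<open>2 B + m \<le> q\<close>. The solvability condition reduces
    to \<open>512 (512 m^2 + 257 m) < 2 B\<close>, true for \<open>q \<ge> 10^6 m^2\<close>, while
    \<open>J / l\<close> is only slightly above one half.\<close>
  have "512 * m * card {x \<in> C. (\<Prod>a\<in>\<sigma> ` T. x - a) ^ n - \<delta> \<in> I} \<le> B + m * n + (257 * m - 1) * q"
  proof (rule I.stepanov_bound[OF pe(1) pI pe(2) q_eq])
    show "x ^ q - x \<in> I" for x
      using pow_q[of "h x"] by (simp add: I_def diff pow)
    show "finite C" "card C = q"
      using fin card_carrier inj by (simp_all add: C_def card_image)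
    show "\<exists>c\<in>C. x - c \<in> I" for x
      by (rule bexI[of _ "\<sigma> (h x)"]) (simp_all add: I_def diff \<sigma> C_def)
    show "a = b" if "a \<in> C" "b \<in> C" "a - b \<in> I" for a b
      using that by (auto simp: C_def I_def diff \<sigma>)
    show "\<sigma> ` T \<subseteq> C" "\<sigma> ` T \<noteq> {}"
      using T by (auto simp: C_def)
    show "a \<notin> I" if "a \<in> \<sigma> ` T" for a
      using that T by (auto simp: I_def \<sigma> subset_iff)
    show "\<delta> \<notin> I"
      using h\<delta> by (simp add: I_def)
    show "m = card (\<sigma> ` T)"
      using inj T by (simp add: m_def card_image inj_on_subset)
    show "2 * B + m \<le> q" "0 < B" "0 < 257 * m"
      using B2 small' mm m by linarith+
    show "512 * m \<le> n" "0 < n"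
      using small' mm q_eq by linarith+
    have "512 * (512 * m\<^sup>2 + 257 * m) = 262144 * m\<^sup>2 + 131584 * m"
      by simp
    then have "512 * (512 * m\<^sup>2 + 257 * m) < 2 * B"
      using B2 small' mm by linarith
    then have "m * (512 * (512 * m\<^sup>2 + 257 * m)) < m * (2 * B)"
      using m by simp
    then show "512 * m * (m * (512 * m) + B + 257 * m) < 2 * (257 * m) * B"
      by (simp add: algebra_simps power2_eq_square)
  qed
  also have "{x \<in> C. (\<Prod>a\<in>\<sigma> ` T. x - a) ^ n - \<delta> \<in> I}
      = \<sigma> ` {y \<in> carrier R. (\<Prod>a\<in>T. qchar R (y \<ominus> a)) = \<epsilon>}"
  proof -
    have "(\<Prod>a\<in>\<sigma> ` T. \<sigma> y - a) ^ n - \<delta> \<in> I \<longleftrightarrow> (\<Prod>a\<in>T. qchar R (y \<ominus> a)) = \<epsilon>"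
      if y: "y \<in> carrier R" for y
    proof -
      have qprod: "qchar R (h (\<Prod>a\<in>A. z a)) = (\<Prod>a\<in>A. qchar R (h (z a)))" for A and z :: "_ \<Rightarrow> int poly"
        by (induction A rule: infinite_finite_induct) (simp_all add: h1 mult qchar_mult)
      have "(\<Prod>a\<in>\<sigma> ` T. \<sigma> y - a) = (\<Prod>a\<in>T. \<sigma> y - \<sigma> a)"
        using inj T by (simp add: prod.reindex inj_on_subset)
      then have "qchar R (h (\<Prod>a\<in>\<sigma> ` T. \<sigma> y - a)) = (\<Prod>a\<in>T. qchar R (y \<ominus> a))"
        using T y by (simp add: qprod diff \<sigma> subset_iff)
      moreover have "(\<Prod>a\<in>\<sigma> ` T. \<sigma> y - a) ^ n - \<delta> \<in> I \<longleftrightarrow> h (\<Prod>a\<in>\<sigma> ` T. \<sigma> y - a) [^] n = h \<delta>"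
        by (simp add: I_def diff pow)
      ultimately show ?thesis
        using \<epsilon> h\<delta> qchar_eq_iff[of "h (\<Prod>a\<in>\<sigma> ` T. \<sigma> y - a)"] by auto
    qed
    then show ?thesis
      by (auto simp: C_def)
  qed
  also have "card \<dots> = card {y \<in> carrier R. (\<Prod>a\<in>T. qchar R (y \<ominus> a)) = \<epsilon>}"
    by (rule card_image, rule inj_on_subset[OF inj]) auto
  finally have *: "512 * m * card {y \<in> carrier R. (\<Prod>a\<in>T. qchar R (y \<ominus> a)) = \<epsilon>}
      \<le> B + m * n + (257 * m - 1) * q" (is "512 * m * ?N \<le> _") .
  then have "512 * (m * ?N) \<le> B + m * n + (257 * m - 1) * q"
    by (simp only: mult.assoc)
  moreover have "(257 * m - 1) * q + q = 257 * (m * q)"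
    using m by (cases m) (simp_all add: algebra_simps)
  moreover have "2 * (m * n) \<le> m * q" "2 * B \<le> q"
    using B2 q_eq by simp_all
  ultimately have "1024 * (m * ?N) \<le> 515 * (m * q)"
    by linarith
  then have "m * (1024 * ?N) \<le> m * (515 * q)"
    by (simp only: mult.left_commute)
  then show ?thesis
    using m by simp
qed

text \<open>The values \<open>1\<close> and \<open>-1\<close> are taken at most
  \<open>515 q / 1024\<close> times each, and together at all but \<open>card T\<close> points; so
  the two counts differ by at most \<open>6 q / 1024 + card T\<close>, which is below
  \<open>q / 64\<close>.\<close>

lemma product_sum_bound:
  assumes T: "T \<subseteq> carrier R" "T \<noteq> {}" and small: "1000000 * (card T)\<^sup>2 \<le> q"
  shows "\<bar>\<Sum>y\<in>carrier R. \<Prod>a\<in>T. qchar R (y \<ominus> a)\<bar> \<le> real q / 64"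
proof -
  have finT: "finite T" using T fin finite_subset by blast
  have cardT: "1 \<le> card T"
    using T finT by (simp add: Suc_le_eq card_gt_0_iff)
  then have "card T \<le> (card T)\<^sup>2" by (simp add: power2_eq_square)
  then have cT: "1000000 * card T \<le> q" using small by linarith
  then have "card T < card (carrier R)"
    using cardT card_carrier by linarith
  \<comment> \<open>Translation by a point outside \<open>T\<close> keeps the sum and moves the set
    away from \<open>\<zero>\<close>.\<close>
  then obtain w where w: "w \<in> carrier R" "w \<notin> T"
    using T by (metis finT card_mono linorder_not_le subsetI)
  define T' where "T' = (\<lambda>a. a \<ominus> w) ` T"
  have inj: "inj_on (\<lambda>a. a \<ominus> w) (carrier R)"
    using w by (auto simp: inj_on_def minus_eq)
  have cardT': "card T' = card T"
    unfolding T'_def using inj T by (intro card_image inj_on_subset[OF inj])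
  have T': "T' \<subseteq> carrier R" "T' \<noteq> {}" "\<zero> \<notin> T'"
    using T w by (auto simp: T'_def subset_iff) (metis r_right_minus_eq)
  define c where "c y = (\<Prod>a\<in>T'. qchar R (y \<ominus> a))" for y
  have "(\<Sum>y\<in>carrier R. \<Prod>a\<in>T. qchar R (y \<ominus> a)) = (\<Sum>y\<in>carrier R. c (y \<ominus> w))"
  proof (rule sum.cong)
    fix y assume y: "y \<in> carrier R"
    have "c (y \<ominus> w) = (\<Prod>a\<in>T. qchar R ((y \<ominus> w) \<ominus> (a \<ominus> w)))"
      unfolding c_def T'_def using inj_on_subset[OF inj T(1)] by (simp add: prod.reindex)
    also have "\<dots> = (\<Prod>a\<in>T. qchar R (y \<ominus> a))"
    proof (rule prod.cong)
      fix a assume "a \<in> T"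
      then have "a \<in> carrier R" using T by blast
      then have "(y \<ominus> w) \<ominus> (a \<ominus> w) = y \<oplus> (\<ominus> w \<oplus> (w \<oplus> \<ominus> a))"
        using y w by (simp add: minus_eq minus_add a_ac)
      also have "\<dots> = y \<ominus> a"
        using y w \<open>a \<in> carrier R\<close> by (simp add: r_neg1 minus_eq)
      finally show "qchar R ((y \<ominus> w) \<ominus> (a \<ominus> w)) = qchar R (y \<ominus> a)" by simp
    qed simp
    finally show "(\<Prod>a\<in>T. qchar R (y \<ominus> a)) = c (y \<ominus> w)" by simp
  qed simp
  also have "\<dots> = (\<Sum>y\<in>(\<lambda>a. a \<ominus> w) ` carrier R. c y)"
    by (simp add: sum.reindex[OF inj])
  also have "(\<lambda>a. a \<ominus> w) ` carrier R = carrier R"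
    using w by (intro endo_inj_surj fin inj) auto
  finally have eq: "(\<Sum>y\<in>carrier R. \<Prod>a\<in>T. qchar R (y \<ominus> a)) = (\<Sum>y\<in>carrier R. c y)" .
  define Np where "Np = {y \<in> carrier R. c y = 1}"
  define Nm where "Nm = {y \<in> carrier R. c y = - 1}"
  have bounds: "1024 * card Np \<le> 515 * q" "1024 * card Nm \<le> 515 * q"
    unfolding Np_def Nm_def c_def using product_count_bound[OF T'] small by (simp_all add: cardT')
  have c_cases: "c y = 1 \<or> c y = - 1 \<or> c y = 0" for y
  proof -
    have "(\<Prod>a\<in>A. qchar R (y \<ominus> a)) \<in> {1, - 1, 0}" for A
    proof (induction A rule: infinite_finite_induct)
      case (insert b A)
      then show ?case using qchar_cases[of "y \<ominus> b"] by auto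
    qed auto
    then show ?thesis by (auto simp: c_def)
  qed
  have c0: "c y = 0 \<longleftrightarrow> y \<in> T'" if "y \<in> carrier R" for y
  proof -
    have "finite T'" using finT by (simp add: T'_def)
    moreover have "y \<ominus> a = \<zero> \<longleftrightarrow> y = a" if "a \<in> T'" for a
      using that T' \<open>y \<in> carrier R\<close> by (simp add: subset_iff)
    ultimately show ?thesis
      by (simp add: c_def qchar_eq_0_iff)
  qed
  have cT': "c y = 0" if "y \<in> T'" for y
    using that c0 T' by blast
  have part: "carrier R = Np \<union> Nm \<union> T'"
    using c_cases c0 T' by (auto simp: Np_def Nm_def)
  have fins: "finite Np" "finite Nm" "finite T'"
    using fin finT by (auto simp: Np_def Nm_def T'_def)
  have disj: "Np \<inter> Nm = {}" "(Np \<union> Nm) \<inter> T' = {}"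
    using cT' by (auto simp: Np_def Nm_def)
  have "card (carrier R) = card Np + card Nm + card T"
    using fins disj by (simp add: part card_Un_disjoint cardT')
  then have "real q = real (card Np) + real (card Nm) + real (card T)"
    by (simp add: card_carrier)
  moreover have "(\<Sum>y\<in>carrier R. c y) = real (card Np) - real (card Nm)"
  proof -
    have "(\<Sum>y\<in>carrier R. c y) = sum c Np + sum c Nm + sum c T'"
      using fins disj by (subst part) (simp add: sum.union_disjoint)
    also have "sum c T' = 0"
      using c0 T' by (intro sum.neutral) auto
    also have "sum c Np = real (card Np)" by (simp add: Np_def)
    also have "sum c Nm = - real (card Nm)" by (simp add: Nm_def)
    finally show ?thesis by simp
  qed
  moreover have "1024 * real (card Np) \<le> 515 * real q" "1024 * real (card Nm) \<le> 515 * real q"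
    "1000000 * real (card T) \<le> real q"
    using bounds cT by linarith+
  ultimately show ?thesis
    unfolding eq abs_le_iff by linarith
qed

end

subsection \<open>Elementary symmetric functions of signs\<close>

text \<open>The elementary symmetric polynomial \<open>e_s\<close> of the values \<open>c y\<close>,
  indexed by points so that equal values count separately.\<close>

definition subset_product_sum :: "('b \<Rightarrow> real) \<Rightarrow> 'b set \<Rightarrow> nat \<Rightarrow> real"
  where "subset_product_sum c V s = (\<Sum>U | U \<subseteq> V \<and> card U = s. \<Prod>y\<in>U. c y)"

lemma subset_product_sum_0: "finite V \<Longrightarrow> subset_product_sum c V 0 = 1"
proof -
  assume "finite V"
  then have "{U. U \<subseteq> V \<and> card U = 0} = {{}}"
    by (auto dest: finite_subset)
  then show ?thesis by (simp add: subset_product_sum_def)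
qed

lemma subset_product_sum_empty: "subset_product_sum c {} (Suc s) = 0"
proof -
  have "{U. U \<subseteq> {} \<and> card U = Suc s} = ({} :: 'a set set)" by auto
  then show ?thesis by (simp only: subset_product_sum_def sum.empty)
qed

lemma subset_product_sum_insert:
  assumes V: "finite V" "v \<notin> V"
  shows "subset_product_sum c (insert v V) (Suc s)
      = subset_product_sum c V (Suc s) + c v * subset_product_sum c V s"
proof -
  let ?A = "{U. U \<subseteq> V \<and> card U = Suc s}" and ?B = "{U. U \<subseteq> V \<and> card U = s}"
  have fin: "finite U" if "U \<subseteq> V" for U using that V finite_subset by blast
  have "U \<in> insert v ` ?B" if U: "U \<subseteq> insert v V" "card U = Suc s" "\<not> U \<subseteq> V" for U
  proof (rule image_eqI)
    have v: "v \<in> U" using U by blast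
    then show "U = insert v (U - {v})" by blast
    have "U - {v} \<subseteq> V" "card (U - {v}) = s" using U v by (blast, simp)
    then show "U - {v} \<in> ?B" by simp
  qed
  then have "{U. U \<subseteq> insert v V \<and> card U = Suc s} \<subseteq> ?A \<union> insert v ` ?B"
    by blast
  moreover have "insert v U \<in> {U. U \<subseteq> insert v V \<and> card U = Suc s}" if "U \<in> ?B" for U
    using that fin[of U] V by (auto simp: card_insert_if)
  ultimately have "{U. U \<subseteq> insert v V \<and> card U = Suc s} = ?A \<union> insert v ` ?B"
    by blast
  moreover have "?A \<inter> insert v ` ?B = {}" using V by auto
  moreover have "finite ?A" "finite ?B" using V by auto
  moreover have inj: "inj_on (insert v) ?B" using V by (intro inj_onI) (metis (no_types, lifting) insert_ident mem_Collect_eq subsetD)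
  ultimately have "subset_product_sum c (insert v V) (Suc s)
      = subset_product_sum c V (Suc s) + (\<Sum>U\<in>?B. \<Prod>y\<in>insert v U. c y)"
    by (simp add: subset_product_sum_def sum.union_disjoint sum.reindex)
  also have "(\<Sum>U\<in>?B. \<Prod>y\<in>insert v U. c y) = (\<Sum>U\<in>?B. c v * (\<Prod>y\<in>U. c y))"
    using V fin by (intro sum.cong refl prod.insert) auto
  finally show ?thesis
    by (simp add: subset_product_sum_def sum_distrib_left)
qed

lemma subset_product_sum_1:
  "finite V \<Longrightarrow> subset_product_sum c V (Suc 0) = (\<Sum>y\<in>V. c y)"
  by (induction V rule: finite_induct)
    (simp_all add: subset_product_sum_empty subset_product_sum_insert subset_product_sum_0)

text \<open>Multiply \<open>e_1\<close> by \<open>e_(s+1)\<close>. A point outside the chosen set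
  produces each set of size \<open>s + 2\<close> exactly \<open>s + 2\<close> times; a point inside
  cancels by \<open>c y * c y = 1\<close> and leaves each set of size \<open>s\<close> exactly
  \<open>card V - s\<close> times. The formal proof is an induction on \<open>V\<close>.\<close>

lemma subset_product_sum_recurrence:
  assumes "finite V" "\<And>y. y \<in> V \<Longrightarrow> c y * c y = 1"
  shows "real (s + 2) * subset_product_sum c V (Suc (Suc s))
    = (\<Sum>y\<in>V. c y) * subset_product_sum c V (Suc s)
      - (real (card V) - real s) * subset_product_sum c V s"
  using assms
proof (induction V arbitrary: s rule: finite_induct)
  case empty
  then show ?case
    by (cases s) (simp_all add: subset_product_sum_empty)
next
  case (insert v V)
  have cv: "c v * c v = 1" "c v * (c v * x) = x" for x
    using insert.prems[of v] by (simp_all flip: mult.assoc)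
  let ?E = "subset_product_sum c V"
  have 1: "real (s + 2) * ?E (Suc (Suc s)) = sum c V * ?E (Suc s) - (real (card V) - real s) * ?E s"
    by (rule insert.IH) (simp add: insert.prems)
  show ?case
  \<comment> \<open>Only for positive \<open>s\<close> does \<open>e_s\<close> over
    \<open>insert v V\<close> split off an \<open>e_(s-1)\<close>, and then the induction hypothesis
    is also used one index lower.\<close>
  proof (cases s)
    case 0
    then show ?thesis
      using 1 insert.hyps cv(1) subset_product_sum_1[of V c]
      by (simp add: subset_product_sum_insert subset_product_sum_0 algebra_simps cv)
  next
    case (Suc t)
    have "real (t + 2) * ?E (Suc (Suc t)) = sum c V * ?E (Suc t) - (real (card V) - real t) * ?E t"
      by (rule insert.IH) (simp add: insert.prems)
    then have 2: "c v * (real (t + 2) * ?E (Suc (Suc t)))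
        = c v * (sum c V * ?E (Suc t) - (real (card V) - real t) * ?E t)"
      by simp
    show ?thesis
      using 1 2 insert.hyps cv(1) Suc
      by (simp add: subset_product_sum_insert algebra_simps cv)
  qed
qed

text \<open>Each of the two terms of the recurrence contributes at most half of the bound: one gains
  \<open>\<mu> / 2\<close> from the small sum of signs, the other has its factor
  \<open>s + 1\<close> bounded by \<open>\<mu>^2 / 2 * Q\<close>.\<close>

lemma subset_product_sum_bound:
  fixes \<mu> Q :: real
  assumes V: "finite V" "\<And>y. y \<in> V \<Longrightarrow> c y * c y = 1" "real (card V) \<le> Q"
    and \<mu>: "0 < \<mu>" "\<mu> \<le> 1" and sum: "\<bar>\<Sum>y\<in>V. c y\<bar> \<le> \<mu> / 2 * Q"
  shows "real s \<le> \<mu>\<^sup>2 / 2 * Q \<Longrightarrow> fact s * \<bar>subset_product_sum c V s\<bar> \<le> (\<mu> * Q) ^ s"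
proof (induction s rule: induct_nat_012)
  case 0
  then show ?case using V by (simp add: subset_product_sum_0)
next
  case 1
  have "0 \<le> Q" using V(3) by linarith
  then have "\<mu> / 2 * Q \<le> \<mu> * Q" using \<mu> by simp
  then show ?case using V sum by (simp add: subset_product_sum_1)
next
  case (ge2 s)
  let ?E = "subset_product_sum c V"
  have Q: "0 \<le> Q" using V(3) by linarith
  have s: "real (Suc s) \<le> \<mu>\<^sup>2 / 2 * Q" "real s \<le> \<mu>\<^sup>2 / 2 * Q" using ge2.prems by simp_all
  have "\<mu>\<^sup>2 \<le> 1" using \<mu> by (simp add: power_le_one)
  then have "\<mu>\<^sup>2 / 2 * Q \<le> 1 * Q" using Q by (intro mult_right_mono) auto
  then have M: "\<bar>real (card V) - real s\<bar> \<le> Q" using s V(3) by linarith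
  have rec: "real (s + 2) * ?E (Suc (Suc s))
      = (\<Sum>y\<in>V. c y) * ?E (Suc s) - (real (card V) - real s) * ?E s"
    by (rule subset_product_sum_recurrence) (use V in auto)
  have "fact (Suc (Suc s)) * ?E (Suc (Suc s))
      = fact (Suc s) * (real (s + 2) * ?E (Suc (Suc s)))"
    by (simp add: algebra_simps)
  also have "\<dots> = (\<Sum>y\<in>V. c y) * (fact (Suc s) * ?E (Suc s))
      - (real (card V) - real s) * (real (Suc s) * (fact s * ?E s))"
    by (simp only: rec) (simp add: algebra_simps)
  finally have "\<bar>fact (Suc (Suc s)) * ?E (Suc (Suc s))\<bar>
      = \<bar>(\<Sum>y\<in>V. c y) * (fact (Suc s) * ?E (Suc s))
      - (real (card V) - real s) * (real (Suc s) * (fact s * ?E s))\<bar>"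
    by (rule arg_cong)
  also have "\<dots> \<le> \<bar>\<Sum>y\<in>V. c y\<bar> * (fact (Suc s) * \<bar>?E (Suc s)\<bar>)
      + \<bar>real (card V) - real s\<bar> * (real (Suc s) * (fact s * \<bar>?E s\<bar>))"
    by (rule order.trans[OF abs_triangle_ineq4]) (simp add: abs_mult)
  also have "\<dots> \<le> \<mu> / 2 * Q * (\<mu> * Q) ^ Suc s + Q * (\<mu>\<^sup>2 / 2 * Q * (\<mu> * Q) ^ s)"
    using ge2.IH s M sum Q \<mu> by (intro add_mono mult_mono) auto
  also have "\<dots> = (\<mu> * Q) ^ Suc (Suc s)"
    by (simp add: power2_eq_square algebra_simps)
  finally show ?case by (simp only: abs_mult abs_of_nonneg[OF fact_ge_zero])
qed

subsection \<open>Counting even induced subdigraphs\<close>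

text \<open>\<open>fact s * (k choose s)\<close> is a falling factorial, all of whose
  \<open>s\<close> factors are at least \<open>x\<close>.\<close>

lemma power_le_fact_binomial:
  fixes x :: real
  shows "0 \<le> x \<Longrightarrow> x + real s \<le> real k \<Longrightarrow> x ^ s \<le> fact s * real (k choose s)"
proof (induction s arbitrary: k)
  case (Suc s)
  obtain k' where k: "k = Suc k'"
    using Suc.prems by (cases k) auto
  have "x ^ Suc s \<le> real k * (fact s * real (k' choose s))"
    unfolding power_Suc using Suc k by (intro mult_mono) auto
  also have "\<dots> = fact s * real (k * (k' choose s))"
    by simp
  also have "k * (k' choose s) = Suc s * (k choose Suc s)"
    unfolding k using Suc_times_binomial_eq[of k' s] by (simp only: mult.commute)
  finally show ?case
    by (simp add: algebra_simps)
qed simp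

section \<open>Sums over pairs of vertex sets\<close>

context paley_field
begin

text \<open>\<open>T\<close> and \<open>U\<close> range independently, so that for each
  \<open>T\<close> the inner sum is an elementary symmetric function; pairs with a common vertex
  contribute zero through the factor \<open>qchar R \<zero>\<close>.\<close>

definition pair_sum :: "nat \<Rightarrow> nat \<Rightarrow> real"
  where "pair_sum t s = (\<Sum>T | T \<subseteq> carrier R \<and> card T = t. \<Sum>U | U \<subseteq> carrier R \<and> card U = s.
      \<Prod>v\<in>T. \<Prod>y\<in>U. qchar R (y \<ominus> v))"

lemma qchar_diff_swap:
  "x \<in> carrier R \<Longrightarrow> y \<in> carrier R \<Longrightarrow> qchar R (x \<ominus> y) = - qchar R (y \<ominus> x)"
  using qchar_minus[of "y \<ominus> x"] by (simp add: minus_eq minus_add a_comm)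

text \<open>Each of the \<open>t * s\<close> factors changes sign when its arguments are exchanged,
  so the two sums agree up to a global sign.\<close>

lemma pair_sum_swap: "\<bar>pair_sum t s\<bar> = \<bar>pair_sum s t\<bar>"
proof -
  have "(\<Prod>v\<in>T. \<Prod>y\<in>U. qchar R (y \<ominus> v)) = (- 1) ^ (t * s) * (\<Prod>y\<in>U. \<Prod>v\<in>T. qchar R (v \<ominus> y))"
    if T: "T \<subseteq> carrier R" "card T = t" and U: "U \<subseteq> carrier R" "card U = s" for T U
  proof -
    have "(\<Prod>v\<in>T. \<Prod>y\<in>U. qchar R (y \<ominus> v)) = (\<Prod>v\<in>T. \<Prod>y\<in>U. (- 1) * qchar R (v \<ominus> y))"
    proof (intro prod.cong refl)
      fix v y assume "v \<in> T" "y \<in> U"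
      then have "v \<in> carrier R" "y \<in> carrier R" using T U by auto
      then show "qchar R (y \<ominus> v) = - 1 * qchar R (v \<ominus> y)"
        using qchar_diff_swap[of y v] by simp
    qed
    also have "\<dots> = ((- 1) ^ s) ^ t * (\<Prod>v\<in>T. \<Prod>y\<in>U. qchar R (v \<ominus> y))"
      by (simp only: prod.distrib prod_constant T U)
    also have "((- 1 :: real) ^ s) ^ t = (- 1) ^ (t * s)"
      by (simp only: power_mult[symmetric] mult.commute)
    also have "(\<Prod>v\<in>T. \<Prod>y\<in>U. qchar R (v \<ominus> y)) = (\<Prod>y\<in>U. \<Prod>v\<in>T. qchar R (v \<ominus> y))"
      by (rule prod.swap)
    finally show ?thesis .
  qed
  then have "pair_sum t s = (\<Sum>T | T \<subseteq> carrier R \<and> card T = t. \<Sum>U | U \<subseteq> carrier R \<and> card U = s.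
      (- 1) ^ (t * s) * (\<Prod>y\<in>U. \<Prod>v\<in>T. qchar R (v \<ominus> y)))"
    unfolding pair_sum_def by (intro sum.cong refl) auto
  also have "\<dots> = (- 1) ^ (t * s) * pair_sum s t"
    unfolding pair_sum_def by (subst sum.swap) (simp add: sum_distrib_left)
  finally show ?thesis
    by (simp add: abs_mult power_abs)
qed

lemma card_subsets: "card {T. T \<subseteq> carrier R \<and> card T = t} = q choose t"
  using n_subsets[OF fin] card_carrier by simp

text \<open>The points of \<open>T\<close> carry \<open>c y = 0\<close> and all others a sign, so
  this is an elementary symmetric function on the complement of \<open>T\<close>. The choice
  \<open>\<mu> = 1 / 32\<close> turns \<open>\<mu> / 2 * q\<close> into the \<open>q / 64\<close> of
  \<open>product_sum_bound\<close>, and \<open>\<mu>^2 / 2 * q\<close> into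
  \<open>q / 2048\<close>.\<close>

lemma inner_sum_bound:
  assumes T: "T \<subseteq> carrier R" "T \<noteq> {}" "1000000 * (card T)\<^sup>2 \<le> q" and s: "2048 * s \<le> q"
  shows "fact s * \<bar>\<Sum>U | U \<subseteq> carrier R \<and> card U = s. \<Prod>y\<in>U. \<Prod>v\<in>T. qchar R (y \<ominus> v)\<bar>
    \<le> (real q / 32) ^ s"
proof -
  define c where "c y = (\<Prod>v\<in>T. qchar R (y \<ominus> v))" for y
  have finT: "finite T" using T fin finite_subset by blast
  have c0: "c y = 0" if "y \<in> T" for y
    using that T finT by (auto simp: c_def qchar_eq_0_iff subset_iff intro!: bexI[of _ y])
  have c1: "c y * c y = 1" if y: "y \<in> carrier R - T" for y
  proof -
    have "qchar R (y \<ominus> v) * qchar R (y \<ominus> v) = 1" if "v \<in> T" for v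
    proof -
      have "y \<ominus> v \<noteq> \<zero>"
        using that y T by (auto simp: subset_iff)
      then show ?thesis
        using qchar_cases[of "y \<ominus> v"] qchar_eq_0_iff[of "y \<ominus> v"] by auto
    qed
    then show ?thesis
      by (simp add: c_def flip: prod.distrib)
  qed
  have "(\<Sum>U | U \<subseteq> carrier R \<and> card U = s. \<Prod>y\<in>U. c y) = subset_product_sum c (carrier R - T) s"
    unfolding subset_product_sum_def
  proof (rule sum.mono_neutral_right)
    show "\<forall>U\<in>{U. U \<subseteq> carrier R \<and> card U = s} - {U. U \<subseteq> carrier R - T \<and> card U = s}. (\<Prod>y\<in>U. c y) = 0"
    proof
      fix U assume U: "U \<in> {U. U \<subseteq> carrier R \<and> card U = s} - {U. U \<subseteq> carrier R - T \<and> card U = s}"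
      then obtain y where "y \<in> U" "y \<in> T" by blast
      moreover have "finite U" using U fin finite_subset by blast
      ultimately show "(\<Prod>y\<in>U. c y) = 0" using c0 by auto
    qed
  qed (use fin in auto)
  moreover have "fact s * \<bar>subset_product_sum c (carrier R - T) s\<bar> \<le> (1 / 32 * real q) ^ s"
  proof (rule subset_product_sum_bound)
    show "finite (carrier R - T)" using fin by simp
    show "\<And>y. y \<in> carrier R - T \<Longrightarrow> c y * c y = 1" by (rule c1)
    show "real (card (carrier R - T)) \<le> real q"
      using card_carrier card_mono[OF fin, of "carrier R - T"] by auto
    have "(\<Sum>y\<in>carrier R - T. c y) = (\<Sum>y\<in>carrier R. c y)"
      by (rule sum.mono_neutral_left) (use fin T c0 in auto)
    then show "\<bar>\<Sum>y\<in>carrier R - T. c y\<bar> \<le> 1 / 32 / 2 * real q"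
      using product_sum_bound[OF T] by (simp add: c_def)
    show "real s \<le> (1 / 32)\<^sup>2 / 2 * real q"
      using s by (simp add: power2_eq_square)
  qed auto
  ultimately show ?thesis
    by (simp add: c_def)
qed

lemma pair_sum_bound:
  assumes t: "1 \<le> t" "t \<le> s" and small: "1000000 * (t + s)\<^sup>2 \<le> q"
  shows "\<bar>pair_sum t s\<bar> \<le> real (q choose (t + s)) * real ((t + s) choose t) * (1 / 4) ^ (t + s)"
proof -
  \<comment> \<open>\<open>Z\<close> stands for \<open>(t + s)^2\<close> and makes the size
    conditions linear.\<close>
  obtain Z where Z: "t + s \<le> Z" "t\<^sup>2 \<le> Z" "1000000 * Z \<le> q"
  proof
    show "t + s \<le> (t + s)\<^sup>2" "t\<^sup>2 \<le> (t + s)\<^sup>2"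
      using t by (simp_all add: power2_eq_square add_mono mult_le_mono)
    show "1000000 * (t + s)\<^sup>2 \<le> q" by (rule small)
  qed
  have inner: "fact s * \<bar>\<Sum>U | U \<subseteq> carrier R \<and> card U = s. \<Prod>v\<in>T. \<Prod>y\<in>U. qchar R (y \<ominus> v)\<bar>
      \<le> (real q / 32) ^ s" if "T \<subseteq> carrier R" "card T = t" for T
  proof -
    have "T \<noteq> {}" using that t by auto
    moreover have "1000000 * (card T)\<^sup>2 \<le> q" "2048 * s \<le> q"
      unfolding that(2) using Z by linarith+
    ultimately show ?thesis
      using inner_sum_bound[of T s] that by (simp add: prod.swap[of _ T])
  qed
  have "fact s * \<bar>pair_sum t s\<bar> \<le> (\<Sum>T | T \<subseteq> carrier R \<and> card T = t.
      fact s * \<bar>\<Sum>U | U \<subseteq> carrier R \<and> card U = s. \<Prod>v\<in>T. \<Prod>y\<in>U. qchar R (y \<ominus> v)\<bar>)"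
    unfolding pair_sum_def sum_distrib_left[symmetric] by (intro mult_left_mono sum_abs) simp
  also have "\<dots> \<le> (\<Sum>T | T \<subseteq> carrier R \<and> card T = t. (real q / 32) ^ s)"
    using inner by (intro sum_mono) auto
  \<comment> \<open>\<open>1 / 32\<close> is split into \<open>1 / 16\<close> and
    \<open>1 / 2\<close>: as \<open>t \<le> s\<close>, \<open>(1 / 16)^s\<close> supplies
    \<open>(1 / 4)^(t + s)\<close>, and \<open>(q / 2)^s\<close> is absorbed by
    \<open>fact s\<close> times a binomial coefficient.\<close>
  also have "\<dots> = real (q choose t) * ((1 / 16) ^ s * (real q / 2) ^ s)"
    by (simp add: card_subsets flip: power_mult_distrib)
  also have "\<dots> \<le> real (q choose t) * ((1 / 4) ^ (t + s) * (fact s * real ((q - t) choose s)))"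
  proof (intro mult_left_mono mult_mono power_le_fact_binomial)
    have "(1 / 16 :: real) ^ s = (1 / 4) ^ (2 * s)"
      by (simp add: power_mult power2_eq_square)
    also have "\<dots> \<le> (1 / 4) ^ (t + s)"
      using t by (intro power_decreasing) auto
    finally show "(1 / 16 :: real) ^ s \<le> (1 / 4) ^ (t + s)" .
    have "2 * (t + s) \<le> 2 * Z" using Z(1) by simp
    also have "\<dots> \<le> q" using Z(3) by simp
    finally have "2 * (t + s) \<le> q" .
    then have "real (2 * (t + s)) \<le> real q" "t \<le> q" by (simp_all only: of_nat_le_iff) simp
    then show "real q / 2 + real s \<le> real (q - t)" by (simp add: of_nat_diff)
  qed auto
  also have "\<dots> = fact s * (real ((q choose t) * ((q - t) choose s)) * (1 / 4) ^ (t + s))"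
    by simp
  also have "(q choose t) * ((q - t) choose s) = (q choose (t + s)) * ((t + s) choose t)"
    using choose_mult[of t "t + s" q] Z by simp
  finally show ?thesis
    by simp
qed

text \<open>The swap puts the smaller of the two sizes first.\<close>

lemma pair_sum_bound':
  assumes t: "1 \<le> t" "t < r" and small: "1000000 * r\<^sup>2 \<le> q"
  shows "\<bar>pair_sum t (r - t)\<bar> \<le> real (q choose r) * real (r choose t) * (1 / 4) ^ r"
proof (cases "t \<le> r - t")
  case True
  then show ?thesis using pair_sum_bound[of t "r - t"] t small by simp
next
  case False
  then have "\<bar>pair_sum (r - t) t\<bar> \<le> real (q choose r) * real (r choose (r - t)) * (1 / 4) ^ r"
    using pair_sum_bound[of "r - t" t] t small by simp
  then show ?thesis
    using t by (simp add: pair_sum_swap[of t] binomial_symmetric[of t r])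
qed

lemma pair_sum_0: "pair_sum 0 r = real (q choose r)" "pair_sum r 0 = real (q choose r)"
proof -
  have "{T. T \<subseteq> carrier R \<and> card T = 0} = {{}}"
    using fin by (auto dest: finite_subset)
  then show "pair_sum 0 r = real (q choose r)" "pair_sum r 0 = real (q choose r)"
    by (simp_all add: pair_sum_def card_subsets)
qed

section \<open>Expansion of the number of even sets into pair sums\<close>

text \<open>Each unordered pair enters in both orders and contributes
  \<open>qchar R (y \<ominus> x) * qchar R (x \<ominus> y) = - 1\<close>.\<close>

lemma prod_ordered_pairs:
  assumes "finite T" "T \<subseteq> carrier R"
  shows "(\<Prod>v\<in>T. \<Prod>y\<in>T - {v}. qchar R (y \<ominus> v)) = (- 1) ^ (card T choose 2)"
  using assms
proof (induction T rule: finite_induct)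
  case (insert x T)
  have x: "x \<in> carrier R" and T: "T \<subseteq> carrier R" using insert.prems by auto
  have 1: "insert x T - {v} = insert x (T - {v})" if "v \<in> T" for v
    using that insert.hyps by auto
  have "(\<Prod>v\<in>insert x T. \<Prod>y\<in>insert x T - {v}. qchar R (y \<ominus> v))
      = (\<Prod>y\<in>insert x T - {x}. qchar R (y \<ominus> x)) * (\<Prod>v\<in>T. \<Prod>y\<in>insert x T - {v}. qchar R (y \<ominus> v))"
    using insert.hyps by simp
  also have "insert x T - {x} = T"
    using insert.hyps by auto
  also have "(\<Prod>v\<in>T. \<Prod>y\<in>insert x T - {v}. qchar R (y \<ominus> v))
      = (\<Prod>v\<in>T. qchar R (x \<ominus> v) * (\<Prod>y\<in>T - {v}. qchar R (y \<ominus> v)))"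
    using insert.hyps by (intro prod.cong refl) (simp add: 1)
  also have "\<dots> = (\<Prod>v\<in>T. qchar R (x \<ominus> v)) * (- 1) ^ (card T choose 2)"
    by (simp add: prod.distrib insert.IH[OF T])
  also have "(\<Prod>y\<in>T. qchar R (y \<ominus> x)) * \<dots>
      = (\<Prod>y\<in>T. qchar R (y \<ominus> x) * qchar R (x \<ominus> y)) * (- 1) ^ (card T choose 2)"
    by (simp add: prod.distrib)
  also have "(\<Prod>y\<in>T. qchar R (y \<ominus> x) * qchar R (x \<ominus> y)) = (\<Prod>y\<in>T. - 1)"
  proof (rule prod.cong)
    fix y assume y: "y \<in> T"
    then have "y \<in> carrier R" "y \<noteq> x" using T insert.hyps by auto
    then have "qchar R (y \<ominus> x) \<noteq> 0" using x by (simp add: qchar_eq_0_iff)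
    then have "qchar R (y \<ominus> x) * qchar R (y \<ominus> x) = 1" using qchar_cases[of "y \<ominus> x"] by auto
    then show "qchar R (y \<ominus> x) * qchar R (x \<ominus> y) = - 1"
      using qchar_diff_swap[of x y] x \<open>y \<in> carrier R\<close> by simp
  qed simp
  finally show ?case
    using insert.hyps by (simp add: numeral_2_eq_2 power_add)
qed (simp add: numeral_2_eq_2)


text \<open>\<open>b v\<close> is \<open>-1\<close> to the power of the out-degree of
  \<open>v\<close>, so the product of all \<open>b v + 1\<close> is \<open>2 ^ card S\<close> or
  \<open>0\<close>; multiplying it out yields the sum over \<open>T\<close>.\<close>

lemma even_paley_indicator:
  assumes S: "S \<subseteq> carrier R"
  shows "(if even_digraph (paley_tournament R \<restriction> S) then 2 ^ card S else 0 :: real)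
    = (\<Sum>T\<in>Pow S. \<Prod>v\<in>T. \<Prod>y\<in>S - {v}. qchar R (y \<ominus> v))"
proof -
  have finS: "finite S" using S fin finite_subset by blast
  define D where "D v = {y \<in> S. nonzero_square R (v \<ominus> y)}" for v
  define b where "b v = (\<Prod>y\<in>S - {v}. qchar R (y \<ominus> v))" for v
  have deg: "out_degree (paley_tournament R \<restriction> S) v = card (D v)" if v: "v \<in> S" for v
  proof -
    have "out_arcs (paley_tournament R \<restriction> S) v = Pair v ` D v"
      using v S by (auto simp: out_arcs_def induce_subgraph_def paley_tournament_def D_def)
    then show ?thesis
      by (simp add: out_degree_def card_image inj_on_def)
  qed
  have b: "b v = (- 1) ^ card (D v)" if v: "v \<in> S" for v
  proof -
    have "v \<ominus> v = \<zero>" using v S by (simp add: subset_iff)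
    then have D: "D v \<subseteq> S - {v}"
      by (auto simp: D_def nonzero_square_def)
    \<comment> \<open>The difference is reversed on purpose: for \<open>y \<noteq> v\<close>,
      \<open>qchar R (y \<ominus> v)\<close> is \<open>-1\<close> exactly when
      \<open>v \<ominus> y\<close> is a nonzero square, so the factors \<open>-1\<close> count
      out-neighbours.\<close>
    have "b v = (\<Prod>y\<in>S - {v}. if y \<in> D v then - 1 else 1)"
      unfolding b_def
    proof (rule prod.cong)
      fix y assume y: "y \<in> S - {v}"
      then have yv: "y \<in> carrier R" "v \<in> carrier R" "v \<noteq> y" using v S by auto
      then have "v \<ominus> y \<noteq> \<zero>" by simp
      then show "qchar R (y \<ominus> v) = (if y \<in> D v then - 1 else 1)"
        using y yv qchar_diff_swap[of y v] by (simp add: qchar_def D_def)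
    qed simp
    also have "\<dots> = (\<Prod>y\<in>D v. - 1)"
      using finS D by (intro prod.mono_neutral_cong_right) auto
    finally show ?thesis by simp
  qed
  have "(\<Sum>T\<in>Pow S. \<Prod>v\<in>T. b v) = (\<Prod>v\<in>S. b v + 1)"
    by (simp add: prod_add[OF finS])
  also have "\<dots> = (if \<forall>v\<in>S. even (card (D v)) then 2 ^ card S else 0)"
  proof (cases "\<forall>v\<in>S. even (card (D v))")
    case True
    then have "(\<Prod>v\<in>S. b v + 1) = (\<Prod>v\<in>S. 2)" by (intro prod.cong) (auto simp: b)
    then show ?thesis using True by simp
  next
    case False
    then obtain v where "v \<in> S" "odd (card (D v))" by blast
    then have "\<exists>v\<in>S. b v + 1 = 0" by (intro bexI[of _ v]) (simp_all add: b)
    then have "(\<Prod>v\<in>S. b v + 1) = 0" using finS by simp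
    then show ?thesis using False by (simp only: if_False)
  qed
  also have "(\<forall>v\<in>S. even (card (D v))) \<longleftrightarrow> even_digraph (paley_tournament R \<restriction> S)"
    using deg by (simp add: even_digraph_def)
  finally show ?thesis
    by (simp add: b_def)
qed

text \<open>The ordered pairs inside \<open>T\<close> produce the sign and leave the pairs between
  \<open>T\<close> and \<open>S - T\<close>.\<close>

lemma prod_split_cross:
  assumes S: "S \<subseteq> carrier R" and T: "T \<subseteq> S"
  shows "(\<Prod>v\<in>T. \<Prod>y\<in>S - {v}. qchar R (y \<ominus> v))
    = (- 1) ^ (card T choose 2) * (\<Prod>v\<in>T. \<Prod>y\<in>S - T. qchar R (y \<ominus> v))"
proof -
  have finS: "finite S" by (rule finite_subset[OF S fin])
  have fins: "finite S" "finite T" using finS finite_subset[OF T finS] by auto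
  have "(\<Prod>v\<in>T. \<Prod>y\<in>S - {v}. qchar R (y \<ominus> v))
      = (\<Prod>v\<in>T. (\<Prod>y\<in>T - {v}. qchar R (y \<ominus> v)) * (\<Prod>y\<in>S - T. qchar R (y \<ominus> v)))"
  proof (rule prod.cong)
    fix v assume "v \<in> T"
    then have "S - {v} = (T - {v}) \<union> (S - T)" "(T - {v}) \<inter> (S - T) = {}" using T by auto
    then show "(\<Prod>y\<in>S - {v}. qchar R (y \<ominus> v))
        = (\<Prod>y\<in>T - {v}. qchar R (y \<ominus> v)) * (\<Prod>y\<in>S - T. qchar R (y \<ominus> v))"
      using fins by (simp add: prod.union_disjoint)
  qed simp
  also have "\<dots> = (- 1) ^ (card T choose 2) * (\<Prod>v\<in>T. \<Prod>y\<in>S - T. qchar R (y \<ominus> v))"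
    using prod_ordered_pairs[of T] fins S T by (simp add: prod.distrib)
  finally show ?thesis .
qed

text \<open>\<open>(S, T)\<close> corresponds to the disjoint pair \<open>(T, S - T)\<close>, and
  overlapping pairs add nothing to \<open>pair_sum\<close>.\<close>

lemma sum_cross_eq_pair_sum:
  assumes t: "t \<le> r"
  shows "(\<Sum>S | S \<subseteq> carrier R \<and> card S = r. \<Sum>T | T \<subseteq> S \<and> card T = t.
      \<Prod>v\<in>T. \<Prod>y\<in>S - T. qchar R (y \<ominus> v)) = pair_sum t (r - t)"
proof -
  let ?g = "\<lambda>T U. \<Prod>v\<in>T. \<Prod>y\<in>U. qchar R (y \<ominus> v)"
  let ?P = "\<lambda>k. {T. T \<subseteq> carrier R \<and> card T = k}"
  have finP: "finite (?P k)" for k using fin by auto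
  have finS: "finite S" if "S \<subseteq> carrier R" for S using that fin finite_subset by blast
  have fin_sub: "finite {T. T \<subseteq> S \<and> card T = t}" if "S \<in> ?P r" for S
    using that finS by auto
  have "(\<Sum>S\<in>?P r. \<Sum>T | T \<subseteq> S \<and> card T = t. ?g T (S - T))
      = (\<Sum>(S, T)\<in>(SIGMA S:?P r. {T. T \<subseteq> S \<and> card T = t}). ?g T (S - T))"
    using fin_sub by (intro sum.Sigma finP) blast
  also have "\<dots> = (\<Sum>(T, U)\<in>{(T, U). T \<in> ?P t \<and> U \<in> ?P (r - t) \<and> T \<inter> U = {}}. ?g T U)"
  proof (rule sum.reindex_bij_witness[where j = "\<lambda>(S, T). (T, S - T)" and i = "\<lambda>(T, U). (T \<union> U, T)"])
    fix x assume "x \<in> (SIGMA S:?P r. {T. T \<subseteq> S \<and> card T = t})"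
    then obtain S T where x: "x = (S, T)" "S \<subseteq> carrier R" "card S = r" "T \<subseteq> S" "card T = t" by auto
    then have "card (S - T) = r - t" using finS by (simp add: card_Diff_subset finite_subset)
    then show "(case x of (S, T) \<Rightarrow> (T, S - T)) \<in> {(T, U). T \<in> ?P t \<and> U \<in> ?P (r - t) \<and> T \<inter> U = {}}"
      using x by auto
    show "(case case x of (S, T) \<Rightarrow> (T, S - T) of (T, U) \<Rightarrow> (T \<union> U, T)) = x"
      using x by auto
    show "(case case x of (S, T) \<Rightarrow> (T, S - T) of (T, U) \<Rightarrow> ?g T U) = (case x of (S, T) \<Rightarrow> ?g T (S - T))"
      using x by simp
  next
    fix x assume "x \<in> {(T, U). T \<in> ?P t \<and> U \<in> ?P (r - t) \<and> T \<inter> U = {}}"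
    then obtain T U where x: "x = (T, U)" "T \<subseteq> carrier R" "card T = t" "U \<subseteq> carrier R"
      "card U = r - t" "T \<inter> U = {}" by auto
    then have "card (T \<union> U) = r" using finS t by (simp add: card_Un_disjoint)
    then show "(case x of (T, U) \<Rightarrow> (T \<union> U, T)) \<in> (SIGMA S:?P r. {T. T \<subseteq> S \<and> card T = t})"
      using x by auto
    show "(case case x of (T, U) \<Rightarrow> (T \<union> U, T) of (S, T) \<Rightarrow> (T, S - T)) = x"
      using x by auto
  qed
  also have "\<dots> = (\<Sum>(T, U)\<in>?P t \<times> ?P (r - t). ?g T U)"
  proof (rule sum.mono_neutral_left)
    show "finite (?P t \<times> ?P (r - t))" using finP by blast
    show "\<forall>x\<in>?P t \<times> ?P (r - t) - {(T, U). T \<in> ?P t \<and> U \<in> ?P (r - t) \<and> T \<inter> U = {}}.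
        (case x of (T, U) \<Rightarrow> ?g T U) = 0"
    proof
      fix x assume "x \<in> ?P t \<times> ?P (r - t) - {(T, U). T \<in> ?P t \<and> U \<in> ?P (r - t) \<and> T \<inter> U = {}}"
      then obtain T U v where x: "x = (T, U)" "T \<subseteq> carrier R" "U \<subseteq> carrier R" "v \<in> T" "v \<in> U"
        by auto
      then have "v \<in> carrier R" by blast
      then have "qchar R (v \<ominus> v) = 0" by (simp add: qchar_eq_0_iff)
      then have "(\<Prod>y\<in>U. qchar R (y \<ominus> v)) = 0" using x finS by (meson prod_zero)
      then have "?g T U = 0" using x finS by (meson prod_zero)
      then show "(case x of (T, U) \<Rightarrow> ?g T U) = 0" using x by simp
    qed
  qed auto
  also have "\<dots> = pair_sum t (r - t)"
    unfolding pair_sum_def by (rule sum.cartesian_product[symmetric])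
  finally show ?thesis .
qed

lemma num_even_induced_expansion:
  "2 ^ r * real (num_even_induced (paley_tournament R) r)
    = (\<Sum>t\<le>r. (- 1) ^ (t choose 2) * pair_sum t (r - t))"
proof -
  let ?P = "{S. S \<subseteq> carrier R \<and> card S = r}"
  let ?e = "\<lambda>S. even_digraph (paley_tournament R \<restriction> S)"
  have finP: "finite ?P" using fin by auto
  have "num_even_induced (paley_tournament R) r = card {S \<in> ?P. ?e S}"
    unfolding num_even_induced_def
    by (rule arg_cong[of _ _ card]) (auto simp: paley_tournament_def)
  then have "2 ^ r * real (num_even_induced (paley_tournament R) r)
      = (\<Sum>S\<in>?P. if ?e S then 2 ^ card S else 0)"
    using finP by (simp add: sum.If_cases Int_def flip: sum.inter_filter)
  also have "\<dots> = (\<Sum>S\<in>?P. \<Sum>T\<in>Pow S. \<Prod>v\<in>T. \<Prod>y\<in>S - {v}. qchar R (y \<ominus> v))"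
    by (rule sum.cong) (use even_paley_indicator in auto)
  also have "\<dots> = (\<Sum>S\<in>?P. \<Sum>t\<le>r. (- 1) ^ (t choose 2) *
      (\<Sum>T | T \<subseteq> S \<and> card T = t. \<Prod>v\<in>T. \<Prod>y\<in>S - T. qchar R (y \<ominus> v)))"
  proof (rule sum.cong)
    fix S assume S: "S \<in> ?P"
    then have finS: "finite S" using fin finite_subset by blast
    have "(\<Sum>T\<in>Pow S. \<Prod>v\<in>T. \<Prod>y\<in>S - {v}. qchar R (y \<ominus> v))
        = (\<Sum>T\<in>Pow S. (- 1) ^ (card T choose 2) * (\<Prod>v\<in>T. \<Prod>y\<in>S - T. qchar R (y \<ominus> v)))"
      using S by (intro sum.cong refl prod_split_cross) auto
    also have "\<dots> = (\<Sum>t\<le>r. \<Sum>T\<in>{T \<in> Pow S. card T = t}.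
        (- 1) ^ (card T choose 2) * (\<Prod>v\<in>T. \<Prod>y\<in>S - T. qchar R (y \<ominus> v)))"
      using S finS by (intro sum.group[symmetric]) (auto intro: card_mono)
    also have "\<dots> = (\<Sum>t\<le>r. (- 1) ^ (t choose 2) *
        (\<Sum>T | T \<subseteq> S \<and> card T = t. \<Prod>v\<in>T. \<Prod>y\<in>S - T. qchar R (y \<ominus> v)))"
      by (intro sum.cong refl) (simp add: sum_distrib_left)
    finally show "(\<Sum>T\<in>Pow S. \<Prod>v\<in>T. \<Prod>y\<in>S - {v}. qchar R (y \<ominus> v)) = \<dots>" .
  qed simp
  also have "\<dots> = (\<Sum>t\<le>r. (- 1) ^ (t choose 2) * pair_sum t (r - t))"
    by (subst sum.swap) (simp add: sum_cross_eq_pair_sum flip: sum_distrib_left)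
  finally show ?thesis .
qed

text \<open>The terms \<open>t = 0\<close> and \<open>t = r\<close> are the main term; for the
  others the factor \<open>(1 / 4) ^ r\<close> beats the sum \<open>2 ^ r\<close> of the binomial
  coefficients.\<close>

lemma num_even_induced_bound:
  assumes r: "1 \<le> r" "r mod 4 = 0 \<or> r mod 4 = 1" and small: "1000000 * r\<^sup>2 \<le> q"
  shows "\<bar>2 ^ r * real (num_even_induced (paley_tournament R) r) - 2 * real (q choose r)\<bar>
    \<le> real (q choose r) * (1 / 2) ^ r"
proof -
  let ?w = "\<lambda>t. (- 1 :: real) ^ (t choose 2)"
  \<comment> \<open>This is the use of \<open>r mod 4\<close>: with \<open>r choose 2\<close> odd,
    the term \<open>t = r\<close> would cancel the term \<open>t = 0\<close>.\<close>
  have "even (r choose 2)"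
  proof -
    obtain k where "r = 4 * k \<or> r = 4 * k + 1"
      using r(2) by (metis add.commute add_0 mod_div_mult_eq mult.commute)
    then have "r * (r - 1) div 2 = 2 * (k * (r - 1)) \<or> r * (r - 1) div 2 = 2 * (k * r)"
      by auto
    then show ?thesis
      by (auto simp: choose_two)
  qed
  then have wr: "?w r = 1" by simp
  have "{..r} = insert 0 (insert r {1..<r})" using r by auto
  then have "2 ^ r * real (num_even_induced (paley_tournament R) r)
      = ?w 0 * pair_sum 0 r + (?w r * pair_sum r 0 + (\<Sum>t\<in>{1..<r}. ?w t * pair_sum t (r - t)))"
    using r unfolding num_even_induced_expansion by simp
  then have "2 ^ r * real (num_even_induced (paley_tournament R) r) - 2 * real (q choose r)
      = (\<Sum>t\<in>{1..<r}. ?w t * pair_sum t (r - t))"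
    unfolding wr by (simp add: pair_sum_0 numeral_2_eq_2)
  also have "\<bar>\<dots>\<bar> \<le> (\<Sum>t\<in>{1..<r}. \<bar>pair_sum t (r - t)\<bar>)"
    by (rule order.trans[OF sum_abs]) (simp add: abs_mult power_abs)
  also have "\<dots> \<le> (\<Sum>t\<in>{1..<r}. real (q choose r) * real (r choose t) * (1 / 4) ^ r)"
    using pair_sum_bound' small by (intro sum_mono) auto
  also have "\<dots> \<le> (\<Sum>t\<le>r. real (q choose r) * real (r choose t) * (1 / 4) ^ r)"
    by (intro sum_mono2) auto
  also have "\<dots> = real (q choose r) * (1 / 4) ^ r * real (\<Sum>t\<le>r. r choose t)"
    by (simp add: sum_distrib_left sum_distrib_right mult_ac)
  also have "\<dots> = real (q choose r) * ((1 / 4) ^ r * 2 ^ r)"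
    by (simp add: choose_row_sum)
  also have "(1 / 4) ^ r * 2 ^ r = (1 / 2 :: real) ^ r"
    by (simp flip: power_mult_distrib)
  finally show ?thesis .
qed

end

section \<open>Asymptotics along the Paley orders\<close>

theorem theorem1p5:
  fixes F :: "nat \<Rightarrow> ('a, 'm) ring_scheme" and r :: "nat \<Rightarrow> nat"
  assumes "\<And>q. q \<in> paley_orders \<Longrightarrow> field (F q)"
    and "\<And>q. q \<in> paley_orders \<Longrightarrow> finite (carrier (F q)) \<and> card (carrier (F q)) = q"
    and "\<And>q. q \<in> paley_orders \<Longrightarrow> r q > 0"
    and "\<And>q. q \<in> paley_orders \<Longrightarrow> r q mod 4 = 0 \<or> r q mod 4 = 1"
    and "filterlim r at_top paley_at_top"
    and "((\<lambda>q. real (r q) / real q powr (1 / 4)) \<longlongrightarrow> 0) paley_at_top"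
  shows "(\<lambda>q. real (num_even_induced (paley_tournament (F q)) (r q)))
           \<sim>[paley_at_top] (\<lambda>q. 2 powr (1 - real (r q)) * real (q choose r q))"
proof (rule asymp_equivI')
  let ?f = "\<lambda>q. real (num_even_induced (paley_tournament (F q)) (r q))
      / (2 powr (1 - real (r q)) * real (q choose r q))"
  have ev_paley: "eventually (\<lambda>q. q \<in> paley_orders) paley_at_top"
    unfolding paley_at_top_def by (simp add: eventually_inf_principal)
  \<comment> \<open>From \<open>r \<le> q^(1/4)\<close> follows \<open>r^2 \<le> sqrt q\<close>, and
    \<open>10^6 * sqrt q \<le> q\<close> once \<open>q \<ge> 10^12\<close>; this gives the size
    condition of \<open>num_even_induced_bound\<close>.\<close>
  have ev_large: "eventually (\<lambda>q. q \<ge> 10 ^ 12) paley_at_top"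
    unfolding paley_at_top_def eventually_inf_principal
    using eventually_ge_at_top[of "10 ^ 12 :: nat"] by (rule eventually_mono) simp
  have ev_small: "eventually (\<lambda>q. real (r q) / real q powr (1 / 4) < 1) paley_at_top"
    using order_tendstoD(2)[OF assms(6), of 1] by simp
  \<comment> \<open>The relative error is exponentially small in \<open>r\<close>, hence tends to
    zero because \<open>r\<close> tends to infinity.\<close>
  have bound: "eventually (\<lambda>q. norm (?f q - 1) \<le> (1 / 2) ^ r q) paley_at_top"
    using ev_paley ev_large ev_small
  proof eventually_elim
    case (elim q)
    have mod: "q mod 4 = 3" "primepow q"
      using elim by (auto simp: paley_orders_def)
    interpret field "F q" using assms(1) elim by blast
    interpret paley_field "F q" q "(q - 1) div 2"
    proof
      show "finite (carrier (F q))" "card (carrier (F q)) = q" "primepow q"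
        using assms(2) elim mod by auto
      show "q = 2 * ((q - 1) div 2) + 1" "odd ((q - 1) div 2)"
        using mod(1) by presburger+
    qed
    have "real q \<ge> real (10 ^ 12)" using elim(2) by (simp only: of_nat_le_iff)
    then have q: "real q \<ge> 10 ^ 12" by simp
    have "real (r q) \<le> real q powr (1 / 4)"
      using elim(3) q by (simp add: divide_less_eq)
    then have "real (r q) ^ 2 \<le> (real q powr (1 / 4)) ^ 2"
      by (intro power_mono) auto
    also have "\<dots> = sqrt (real q)"
      using q by (simp add: powr_half_sqrt[symmetric] powr_powr flip: powr_numeral)
    finally have "1000000 * real (r q) ^ 2 \<le> 1000000 * sqrt (real q)" by simp
    also have "\<dots> \<le> sqrt (real q) * sqrt (real q)"
      using q by (intro mult_right_mono real_le_rsqrt) auto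
    also have "\<dots> = real q" using q by simp
    finally have "real (1000000 * (r q)\<^sup>2) \<le> real q" by simp
    then have small: "1000000 * (r q)\<^sup>2 \<le> q" by (simp only: of_nat_le_iff)
    have "r q \<le> (r q)\<^sup>2" by (simp add: power2_eq_square)
    then have "r q \<le> q" using small by linarith
    then have pos: "real (q choose r q) > 0" by simp
    have "1 \<le> r q" using assms(3) elim by (simp add: Suc_le_eq)
    then have main: "\<bar>2 ^ r q * real (num_even_induced (paley_tournament (F q)) (r q)) - 2 * real (q choose r q)\<bar>
        \<le> real (q choose r q) * (1 / 2) ^ r q"
      using num_even_induced_bound assms(4) elim small by blast
    have "2 powr (1 - real (r q)) = 2 / 2 ^ r q"
      by (simp add: powr_diff powr_realpow)
    then have "?f q - 1 = (2 ^ r q * real (num_even_induced (paley_tournament (F q)) (r q))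
        - 2 * real (q choose r q)) / (2 * real (q choose r q))"
      using pos by (simp add: field_simps)
    then have "norm (?f q - 1) = \<bar>2 ^ r q * real (num_even_induced (paley_tournament (F q)) (r q))
        - 2 * real (q choose r q)\<bar> / (2 * real (q choose r q))"
      by (simp only: real_norm_def abs_divide abs_mult abs_of_nat abs_numeral)
    also have "\<dots> \<le> real (q choose r q) * (1 / 2) ^ r q / (2 * real (q choose r q))"
      by (intro divide_right_mono main) simp
    also have "\<dots> \<le> (1 / 2) ^ r q"
      using pos by (simp add: field_simps)
    finally show ?case .
  qed
  have "((\<lambda>q. (1 / 2 :: real) ^ r q) \<longlongrightarrow> 0) paley_at_top"
    by (rule filterlim_compose[OF LIMSEQ_realpow_zero assms(5)]) auto
  then have "((\<lambda>q. ?f q - 1) \<longlongrightarrow> 0) paley_at_top"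
    by (rule Lim_null_comparison[OF bound])
  then show "(?f \<longlongrightarrow> 1) paley_at_top"
    by (simp add: LIM_zero_iff)
qed

end
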